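(* Let $A\subset\mathbb{R}^{n+1}$ be open, $u_0\colon A\to\mathbb{R}$ locally Lipschitz and maximal, and let $(\Omega,u)$ be the singularity resolving solution with initial value $u_0$ constructed as described in the context. Let $\tilde v$ and $\mathcal{D}_t$ be as in the context. If the level set evolution of $\partial\Omega_0$ does not fatten, i.e. $\mathcal{H}^{n+1}(\{x\colon\tilde v(x,t)=0\})=0$ for all $t\ge0$, then $\partial^\mu\Omega_t=\partial^\mu\mathcal{D}_t$ for every $t\ge0$.
   Context: Maximal: $u_0$ is bounded below and proper (preimages of compact sets are compact subsets of $A$). For relatively open $\Omega\subset\mathbb{R}^{n+1}\times[0,\infty)$ let $\Omega_t:=\{x\colon (x,t)\in\Omega\}$. A singularity resolving solution with initial value $u_0$ is a pair $(\Omega,u)$, $\Omega$ relatively open in $\mathbb{R}^{n+1}\times[0,\infty)$ with $\Omega_0=A$, $u\colon\Omega\to\mathbb{R}$ continuous, $C^{2;1}$ on $\Omega\setminus(\Omega_0\times\{0\})$, solving $\dot u=\sqrt{1+|Du|^2}\,\mathrm{div}(Du/\sqrt{1+|Du|^2})$ there, $u(\cdot,0)=u_0$, $u$ bounded below and $u|_{\Omega\cap(\mathbb{R}^{n+1}\times[0,T])}$ proper for every $T>0$. The solution considered is the one constructed in the paper's existence theorem: for $L\in\mathbb{N}$ let $u^L\colon\mathbb{R}^{n+1}\times[0,\infty)\to\mathbb{R}$ be the entire smooth solution of graphical mean curvature flow with initial value $\min\{u_0,L\}$ (set equal to $L$ outside $A$), obtained as a limit of solutions to Dirichlet problems on large balls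 with boundary value $L$ and mollified initial data; then along a subsequence $L\to\infty$, $u^L\to u$ locally uniformly on $\Omega$ and $u^L(x,t)\to\infty$ for $(x,t)\notin\Omega$. Level set flow: a function $\phi$ solves the level set equation if it is a viscosity solution of $\partial_t\phi-\left(\delta^{ij}-\frac{\phi_i\phi_j}{|D\phi|^2}\right)\phi_{ij}=0$; for bounded uniformly continuous initial data there is a unique bounded uniformly continuous viscosity solution. Distance functions are signed distance functions truncated to $[-1,1]$, negative inside the set. Let $\tilde v\colon\mathbb{R}^{n+1}\times[0,\infty)\to\mathbb{R}$ be the solution of the level set equation with $\tilde v(\cdot,0)$ the truncated signed distance function to $\partial\Omega_0$, negative in $\Omega_0$, and $\mathcal{D}_t:=\{x\in\mathbb{R}^{n+1}\colon\tilde v(x,t)<0\}$. For measurable $E\subset\mathbb{R}^{n+1}$, the measure theoretic boundary is $\partial^\mu E:=\{x\colon \forall r>0\colon 0<|E\cap B_r(x)|<|B_r(x)|\}$ ($|\cdot|$ Lebesgue measure). *)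

theory Defs
  imports "HOL-Analysis.Analysis"
begin

text \<open>Space-time points are pairs (x,t) :: 'a \<times> real, where 'a :: euclidean_space
  plays the role of R^(n+1) (DIM('a) = n+1).\<close>

definition sgrad :: "('a::euclidean_space \<times> real \<Rightarrow> real) \<Rightarrow> 'a \<times> real \<Rightarrow> 'a" where
  "sgrad u p = (SOME g. ((\<lambda>y. u (y, snd p)) has_derivative (\<lambda>h. g \<bullet> h)) (at (fst p)))"

definition tder :: "('a::euclidean_space \<times> real \<Rightarrow> real) \<Rightarrow> 'a \<times> real \<Rightarrow> real" where
  "tder u p = (SOME d. ((\<lambda>s. u (fst p, s)) has_real_derivative d) (at (snd p)))"

definition shess :: "('a::euclidean_space \<times> real \<Rightarrow> real) \<Rightarrow> 'a \<times> real \<Rightarrow> 'a \<Rightarrow> 'a" where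
  "shess u p = frechet_derivative (\<lambda>y. sgrad u (y, snd p)) (at (fst p))"

definition sdiv :: "('a::euclidean_space \<times> real \<Rightarrow> 'a) \<Rightarrow> 'a \<times> real \<Rightarrow> real" where
  "sdiv F p = (\<Sum>b\<in>Basis. frechet_derivative (\<lambda>y. F (y, snd p)) (at (fst p)) b \<bullet> b)"

text \<open>C^{2;1} on a set S (used for S open in space-time): continuous, twice
  continuously differentiable in space, once continuously differentiable in time.\<close>
definition C21_on :: "('a::euclidean_space \<times> real) set \<Rightarrow> ('a \<times> real \<Rightarrow> real) \<Rightarrow> bool" where
  "C21_on S u \<longleftrightarrow> continuous_on S u \<and>
     (\<forall>p\<in>S. (\<lambda>y. u (y, snd p)) differentiable (at (fst p))
          \<and> (\<lambda>s. u (fst p, s)) differentiable (at (snd p))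
          \<and> (\<lambda>y. sgrad u (y, snd p)) differentiable (at (fst p))) \<and>
     continuous_on S (sgrad u) \<and> continuous_on S (tder u) \<and>
     (\<forall>h. continuous_on S (\<lambda>p. shess u p h))"

definition gmcf_at :: "('a::euclidean_space \<times> real \<Rightarrow> real) \<Rightarrow> 'a \<times> real \<Rightarrow> bool" where
  "gmcf_at u p \<longleftrightarrow> tder u p = sqrt (1 + (norm (sgrad u p))\<^sup>2) *
      sdiv (\<lambda>q. (1 / sqrt (1 + (norm (sgrad u q))\<^sup>2)) *\<^sub>R sgrad u q) p"

definition gmcf_classical :: "('a::euclidean_space \<times> real) set \<Rightarrow> ('a \<times> real \<Rightarrow> real) \<Rightarrow> bool" where
  "gmcf_classical S u \<longleftrightarrow> C21_on S u \<and> (\<forall>p\<in>S. gmcf_at u p)"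

section \<open>Level set equation (viscosity sense, Evans--Spruck)\<close>

definition strace :: "('a::euclidean_space \<Rightarrow> 'a) \<Rightarrow> real" where
  "strace H = (\<Sum>b\<in>Basis. H b \<bullet> b)"

definition ls_subsol :: "('a::euclidean_space \<times> real \<Rightarrow> real) \<Rightarrow> bool" where
  "ls_subsol \<phi> \<longleftrightarrow> (\<forall>\<psi> U p0. open U \<and> p0 \<in> U \<and> U \<subseteq> UNIV \<times> {0<..} \<and> C21_on U \<psi> \<and>
       (\<forall>p\<in>U. \<phi> p - \<psi> p \<le> \<phi> p0 - \<psi> p0) \<longrightarrow>
       (if sgrad \<psi> p0 \<noteq> 0 then
          tder \<psi> p0 \<le> strace (shess \<psi> p0)
             - (shess \<psi> p0 (sgrad \<psi> p0) \<bullet> sgrad \<psi> p0) / (norm (sgrad \<psi> p0))\<^sup>2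
        else (\<exists>\<eta>. norm \<eta> \<le> 1 \<and> tder \<psi> p0 \<le> strace (shess \<psi> p0) - shess \<psi> p0 \<eta> \<bullet> \<eta>)))"

definition ls_supersol :: "('a::euclidean_space \<times> real \<Rightarrow> real) \<Rightarrow> bool" where
  "ls_supersol \<phi> \<longleftrightarrow> (\<forall>\<psi> U p0. open U \<and> p0 \<in> U \<and> U \<subseteq> UNIV \<times> {0<..} \<and> C21_on U \<psi> \<and>
       (\<forall>p\<in>U. \<phi> p - \<psi> p \<ge> \<phi> p0 - \<psi> p0) \<longrightarrow>
       (if sgrad \<psi> p0 \<noteq> 0 then
          tder \<psi> p0 \<ge> strace (shess \<psi> p0)
             - (shess \<psi> p0 (sgrad \<psi> p0) \<bullet> sgrad \<psi> p0) / (norm (sgrad \<psi> p0))\<^sup>2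
        else (\<exists>\<eta>. norm \<eta> \<le> 1 \<and> tder \<psi> p0 \<ge> strace (shess \<psi> p0) - shess \<psi> p0 \<eta> \<bullet> \<eta>)))"

text \<open>Bounded uniformly continuous viscosity solution on R^(n+1) x [0,oo)
  with initial value \<phi>0 (unique by the comparison principle).\<close>
definition levelset_solution ::
  "('a::euclidean_space \<times> real \<Rightarrow> real) \<Rightarrow> ('a \<Rightarrow> real) \<Rightarrow> bool" where
  "levelset_solution \<phi> \<phi>0 \<longleftrightarrow>
     bounded (\<phi> ` (UNIV \<times> {0..})) \<and> uniformly_continuous_on (UNIV \<times> {0..}) \<phi> \<and>
     ls_subsol \<phi> \<and> ls_supersol \<phi> \<and> (\<forall>x. \<phi> (x, 0) = \<phi>0 x)"

text \<open>Signed distance to the boundary of A, negative in A, truncated to [-1,1].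
  (If the boundary is empty the distance is +oo, so the truncated value is \<plusminus>1.)\<close>
definition trunc_sdist :: "'a::euclidean_space set \<Rightarrow> 'a \<Rightarrow> real" where
  "trunc_sdist A x =
     (if frontier A = {} then (if x \<in> A then -1 else 1)
      else max (-1) (min 1 (if x \<in> A then - infdist x (frontier A) else infdist x (frontier A))))"

definition mboundary :: "'a::euclidean_space set \<Rightarrow> 'a set" where
  "mboundary E = {x. \<forall>r>0. 0 < emeasure lebesgue (E \<inter> ball x r)
                            \<and> emeasure lebesgue (E \<inter> ball x r) < emeasure lebesgue (ball x r)}"

definition locally_lipschitz_on :: "'a::euclidean_space set \<Rightarrow> ('a \<Rightarrow> real) \<Rightarrow> bool" where
  "locally_lipschitz_on A f \<longleftrightarrow>
     (\<forall>x\<in>A. \<exists>r>0. \<exists>K. \<forall>y\<in>A \<inter> ball x r. \<forall>z\<in>A \<inter> ball x r. \<bar>f y - f z\<bar> \<le> K * dist y z)"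

definition maximal_init :: "'a::euclidean_space set \<Rightarrow> ('a \<Rightarrow> real) \<Rightarrow> bool" where
  "maximal_init A u0 \<longleftrightarrow> bdd_below (u0 ` A) \<and>
     (\<forall>K. compact K \<longrightarrow> compact {x\<in>A. u0 x \<in> K})"

definition tslice :: "('a \<times> real) set \<Rightarrow> real \<Rightarrow> 'a set" where
  "tslice \<Omega> t = {x. (x, t) \<in> \<Omega>}"

definition sing_resolving_solution ::
  "'a::euclidean_space set \<Rightarrow> ('a \<Rightarrow> real) \<Rightarrow> ('a \<times> real) set \<Rightarrow> ('a \<times> real \<Rightarrow> real) \<Rightarrow> bool" where
  "sing_resolving_solution A u0 \<Omega> u \<longleftrightarrow>
     openin (top_of_set (UNIV \<times> {0..})) \<Omega> \<and> tslice \<Omega> 0 = A \<and>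
     continuous_on \<Omega> u \<and>
     gmcf_classical (\<Omega> - A \<times> {0}) u \<and>
     (\<forall>x\<in>A. u (x, 0) = u0 x) \<and>
     bdd_below (u ` \<Omega>) \<and>
     (\<forall>T>0. \<forall>K. compact K \<longrightarrow> compact {p\<in>\<Omega>. snd p \<le> T \<and> u p \<in> K})"

coinductive smooth_fn :: "('a::euclidean_space \<Rightarrow> real) \<Rightarrow> bool" where
  "(\<forall>x. f differentiable (at x)) \<Longrightarrow>
   (\<forall>b\<in>Basis. smooth_fn (\<lambda>x. frechet_derivative f (at x) b)) \<Longrightarrow> smooth_fn f"

definition mollifier :: "('a::euclidean_space \<Rightarrow> real) \<Rightarrow> bool" where
  "mollifier \<rho> \<longleftrightarrow> smooth_fn \<rho> \<and> (\<forall>x. 0 \<le> \<rho> x) \<and> bounded {x. \<rho> x \<noteq> 0} \<and>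
     (\<rho> has_integral 1) UNIV"

definition mollify :: "('a::euclidean_space \<Rightarrow> real) \<Rightarrow> real \<Rightarrow> ('a \<Rightarrow> real) \<Rightarrow> 'a \<Rightarrow> real" where
  "mollify \<rho> \<epsilon> f x = integral UNIV (\<lambda>y. (1 / \<epsilon> ^ DIM('a)) * \<rho> ((1 / \<epsilon>) *\<^sub>R y) * f (x - y))"

definition cut_init :: "'a set \<Rightarrow> ('a \<Rightarrow> real) \<Rightarrow> real \<Rightarrow> 'a \<Rightarrow> real" where
  "cut_init A u0 L x = (if x \<in> A then min (u0 x) L else L)"

definition dirichlet_sol ::
  "real \<Rightarrow> real \<Rightarrow> ('a::euclidean_space \<Rightarrow> real) \<Rightarrow> ('a \<times> real \<Rightarrow> real) \<Rightarrow> bool" where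
  "dirichlet_sol R L g w \<longleftrightarrow>
     continuous_on (cball 0 R \<times> {0..}) w \<and>
     gmcf_classical (ball 0 R \<times> {0<..}) w \<and>
     (\<forall>x t. norm x = R \<and> 0 \<le> t \<longrightarrow> w (x, t) = L) \<and>
     (\<forall>x\<in>cball 0 R. w (x, 0) = g x)"

definition approx_entire_sol ::
  "'a::euclidean_space set \<Rightarrow> ('a \<Rightarrow> real) \<Rightarrow> real \<Rightarrow> ('a \<times> real \<Rightarrow> real) \<Rightarrow> bool" where
  "approx_entire_sol A u0 L v \<longleftrightarrow>
     continuous_on (UNIV \<times> {0..}) v \<and>
     gmcf_classical (UNIV \<times> {0<..}) v \<and>
     (\<forall>x. v (x, 0) = cut_init A u0 L x) \<and>
     (\<exists>\<rho> \<epsilon> R w. mollifier \<rho> \<and> (\<forall>k. 0 < \<epsilon> k) \<and> \<epsilon> \<longlonglongrightarrow> 0 \<and>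
        filterlim R at_top sequentially \<and>
        (\<forall>k. dirichlet_sol (R k) L (mollify \<rho> (\<epsilon> k) (cut_init A u0 L)) (w k)) \<and>
        (\<forall>K. compact K \<and> K \<subseteq> UNIV \<times> {0..} \<longrightarrow> uniform_limit K w v sequentially))"

definition constructed_srs ::
  "'a::euclidean_space set \<Rightarrow> ('a \<Rightarrow> real) \<Rightarrow> ('a \<times> real) set \<Rightarrow> ('a \<times> real \<Rightarrow> real) \<Rightarrow> bool" where
  "constructed_srs A u0 \<Omega> u \<longleftrightarrow>
     sing_resolving_solution A u0 \<Omega> u \<and>
     (\<exists>U \<sigma>. (\<forall>L::nat. approx_entire_sol A u0 (real L) (U L)) \<and> strict_mono \<sigma> \<and>
        (\<forall>K. compact K \<and> K \<subseteq> \<Omega> \<longrightarrow> uniform_limit K (\<lambda>k. U (\<sigma> k)) u sequentially) \<and>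
        (\<forall>p. snd p \<ge> 0 \<and> p \<notin> \<Omega> \<longrightarrow> filterlim (\<lambda>k. U (\<sigma> k) p) at_top sequentially))"

end

(*
  Double the space variable and minimise
    V(x,t) + th(t) + b |x|^2 + K |x - y|^4 + f(u(y,t)),
  where V is v or -v and u solves graphical mean curvature flow. As u is smooth, no theorem on sums
  is needed: letting y = y0 + B (x - x0) depend linearly on x turns the last terms into a test
  function for V. Put a = x0 - y0. If K |a|^2 is small, B = 0 already contradicts th' > 0; otherwise
  B is the reflection that carries the hyperplane orthogonal to the gradient of the test function to
  the one orthogonal to Du, so that the two elliptic operators match up to small errors. These errors
  are controlled by the second-order condition in y and by |Du| being large, since f is nearly flat.

  With V = -v and f(s) = eps (s + c), properness of u on Omega gives v <= 0 on Omega. With V = v, u the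
  entire solution u^L and f(s) = eta exp(eps (z - s)), one gets a bound for u^L, uniform in L, at each
  point where v < 0; since u^L tends to infinity off Omega, {v < 0} is contained in Omega. Hence the
  time slices of Omega and of {v < 0} differ by a subset of the null set {v = 0}.
*)

theory Submission
  imports Defs
begin

text \<open>For \<open>w = eps * u\<close> the graphical equation becomes
  \<open>w_t = tr D^2w - D^2w(Dw,Dw) / (eps^2 + |Dw|^2)\<close>, the elliptic regularisation of the
  level set equation. This is why a nearly flat function of \<open>u\<close> can serve as an
  approximate level set solution. The level set operator is singular where the gradient vanishes.
  With the fourth power, the gradient of the penalty (\<open>4K|a|^3\<close>) and its Hessian (of
  size \<open>K|a|^2\<close>) vanish together: either the Hessian is negligible or the gradient has
  a positive lower bound. So \<open>K\<close> stays fixed, and only \<open>b\<close> and the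
  derivatives of \<open>f\<close> are made small. The term \<open>b |x|^2\<close> tilts the gradient
  in \<open>x\<close> away from the direction of \<open>Du\<close>. The Hessian of \<open>u\<close>
  has no a priori bound, so a plain translation (\<open>B\<close> the identity) would leave an
  uncontrolled error from the two different directions. The reflection matches the directions
  exactly and shifts the cost to the explicit Hessian of the penalty.\<close>

section \<open>Test functions\<close>

text \<open>The derivatives are explicit arguments because \<open>sgrad\<close>, \<open>tder\<close>
  and \<open>shess\<close> rest on choice. Test functions can thus be differentiated by the
  \<open>has_derivative\<close> rules; \<open>jets_imp_C21_on\<close> identifies the results with
  the chosen derivatives afterwards.\<close>

definition jets ::
  "('a::euclidean_space \<times> real) set \<Rightarrow> ('a \<times> real \<Rightarrow> real) \<Rightarrow> ('a \<times> real \<Rightarrow> real) \<Rightarrow>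
   ('a \<times> real \<Rightarrow> 'a) \<Rightarrow> ('a \<times> real \<Rightarrow> 'a \<Rightarrow> 'a) \<Rightarrow> bool" where
  "jets W u d g H \<longleftrightarrow>
     (\<forall>y t. (y, t) \<in> W \<longrightarrow>
        ((\<lambda>y. u (y, t)) has_derivative (\<lambda>h. g (y, t) \<bullet> h)) (at y) \<and>
        ((\<lambda>s. u (y, s)) has_real_derivative d (y, t)) (at t) \<and>
        ((\<lambda>y. g (y, t)) has_derivative H (y, t)) (at y)) \<and>
     continuous_on W u \<and> continuous_on W d \<and> continuous_on W g \<and>
     (\<forall>h. continuous_on W (\<lambda>p. H p h))"

lemma sgrad_eqI:
  assumes "((\<lambda>y. u (y, snd p)) has_derivative (\<lambda>h. g \<bullet> h)) (at (fst p))"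
  shows "sgrad u p = g"
  unfolding sgrad_def
proof (rule some_equality, fact)
  fix g' assume "((\<lambda>y. u (y, snd p)) has_derivative (\<lambda>h. g' \<bullet> h)) (at (fst p))"
  then have "(\<lambda>h. g' \<bullet> h) = (\<lambda>h. g \<bullet> h)"
    using assms has_derivative_unique by blast
  then have "g' \<bullet> h = g \<bullet> h" for h by metis
  then show "g' = g" using vector_eq_rdot by blast
qed

lemma tder_eqI:
  assumes "((\<lambda>s. u (fst p, s)) has_real_derivative d) (at (snd p))"
  shows "tder u p = d"
  unfolding tder_def using assms DERIV_unique by (blast intro: some_equality)

lemma has_derivative_sgrad:
  assumes "(\<lambda>y. u (y, snd p)) differentiable (at (fst p))"
  shows "((\<lambda>y. u (y, snd p)) has_derivative (\<lambda>h. sgrad u p \<bullet> h)) (at (fst p))"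
proof -
  obtain D where D: "((\<lambda>y. u (y, snd p)) has_derivative D) (at (fst p))"
    using assms by (auto simp: differentiable_def)
  then have lin: "linear D" by (rule has_derivative_linear)
  have "D h = (adjoint D 1) \<bullet> h" for h
    using adjoint_works[OF lin, of h 1] by (simp add: inner_commute)
  then have "D = (\<lambda>h. (adjoint D 1) \<bullet> h)" by auto
  with D have "((\<lambda>y. u (y, snd p)) has_derivative (\<lambda>h. (adjoint D 1) \<bullet> h)) (at (fst p))"
    by simp
  with sgrad_eqI[OF this] show ?thesis by simp
qed

lemma open_time_slice:
  assumes "open (W :: ('a::topological_space \<times> 'b::topological_space) set)"
  shows "open {y. (y, t) \<in> W}"
  using open_vimage[OF assms, of "\<lambda>y. (y, t)"] by (simp add: vimage_def continuous_on_Pair)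

lemma C21_on_imp_jets:
  assumes "C21_on W u"
  shows "jets W u (tder u) (sgrad u) (shess u)"
proof -
  have "((\<lambda>s. u (y, s)) has_real_derivative tder u (y, t)) (at t)"
    if "(y, t) \<in> W" for y t
  proof -
    have "(\<lambda>s. u (y, s)) differentiable (at t)"
      using assms that unfolding C21_on_def by force
    then obtain D where "((\<lambda>s. u (y, s)) has_real_derivative D) (at t)"
      using real_differentiable_def by blast
    with tder_eqI[of u "(y, t)" D] show ?thesis by simp
  qed
  moreover have "((\<lambda>y. u (y, t)) has_derivative (\<lambda>h. sgrad u (y, t) \<bullet> h)) (at y)"
    if "(y, t) \<in> W" for y t
    using assms that has_derivative_sgrad[of u "(y, t)"] unfolding C21_on_def by force
  moreover have "((\<lambda>y. sgrad u (y, t)) has_derivative shess u (y, t)) (at y)"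
    if "(y, t) \<in> W" for y t
    using assms that unfolding C21_on_def shess_def by (force simp: frechet_derivative_works)
  ultimately show ?thesis
    using assms unfolding C21_on_def jets_def by simp
qed

lemma jets_imp_C21_on:
  assumes "jets W u d g H" "open W"
  shows "C21_on W u"
    and "p \<in> W \<Longrightarrow> sgrad u p = g p"
    and "p \<in> W \<Longrightarrow> tder u p = d p"
    and "p \<in> W \<Longrightarrow> shess u p = H p"
proof -
  show sg: "sgrad u p = g p" if "p \<in> W" for p
    using that assms(1) unfolding jets_def by (intro sgrad_eqI) (cases p, auto)
  show td: "tder u p = d p" if "p \<in> W" for p
    using that assms(1) unfolding jets_def by (intro tder_eqI) (cases p, auto)
  have dg: "((\<lambda>y. sgrad u (y, snd p)) has_derivative H p) (at (fst p))" if "p \<in> W" for p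
  proof (rule has_derivative_transform_within_open)
    show "((\<lambda>y. g (y, snd p)) has_derivative H p) (at (fst p))"
      using that assms(1) unfolding jets_def by (cases p) auto
    show "open {y. (y, snd p) \<in> W}" using assms(2) by (rule open_time_slice)
  qed (use that sg in auto)
  show sh: "shess u p = H p" if "p \<in> W" for p
    unfolding shess_def using dg[OF that] by (rule frechet_derivative_at[symmetric])
  have "continuous_on W (sgrad u) \<and> continuous_on W (tder u) \<and>
     (\<forall>h. continuous_on W (\<lambda>p. shess u p h))"
    using assms(1) sg td sh unfolding jets_def by (simp cong: continuous_on_cong)
  moreover have "(\<lambda>y. u (y, snd p)) differentiable (at (fst p))
          \<and> (\<lambda>s. u (fst p, s)) differentiable (at (snd p))
          \<and> (\<lambda>y. sgrad u (y, snd p)) differentiable (at (fst p))" if "p \<in> W" for p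
    using that dg[OF that] assms(1) unfolding jets_def
    by (cases p) (auto simp: differentiable_def has_field_derivative_def)
  ultimately show "C21_on W u"
    using assms(1) unfolding C21_on_def jets_def by blast
qed

lemma jets_uminus:
  assumes "jets W u d g H"
  shows "jets W (\<lambda>p. - u p) (\<lambda>p. - d p) (\<lambda>p. - g p) (\<lambda>p h. - H p h)"
proof -
  have "((\<lambda>y. - u (y, t)) has_derivative (\<lambda>h. - g (y, t) \<bullet> h)) (at y)" if "(y, t) \<in> W" for y t
    using assms that has_derivative_minus[of "\<lambda>y. u (y, t)" "\<lambda>h. g (y, t) \<bullet> h" "at y"]
    unfolding jets_def by (simp add: inner_minus_left)
  then show ?thesis
    using assms unfolding jets_def
    by (auto intro!: continuous_intros has_derivative_minus DERIV_minus simp del: inner_minus_left)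
qed

text \<open>Weaker than being a viscosity supersolution, in a form that sub- and supersolutions share:
  the equation is odd, so \<open>- \<phi>\<close> qualifies when \<open>\<phi>\<close> is a subsolution.\<close>

definition supersol_test :: "('a::euclidean_space \<times> real \<Rightarrow> real) \<Rightarrow> bool" where
  "supersol_test \<phi> \<longleftrightarrow>
     (\<forall>\<psi> U p d g H. open U \<longrightarrow> p \<in> U \<longrightarrow> U \<subseteq> UNIV \<times> {0<..} \<longrightarrow> jets U \<psi> d g H \<longrightarrow>
        (\<forall>q\<in>U. \<phi> p - \<psi> p \<le> \<phi> q - \<psi> q) \<longrightarrow>
        (\<exists>n. norm n \<le> 1 \<and> (g p \<noteq> 0 \<longrightarrow> n = (1 / norm (g p)) *\<^sub>R g p) \<and>
             strace (H p) - H p n \<bullet> n \<le> d p))"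

lemma jets_linear:
  assumes "jets W u d g H" "p \<in> W"
  shows "linear (H p)"
  using assms unfolding jets_def by (cases p) (auto dest: has_derivative_linear)

lemma strace_uminus: "strace (\<lambda>h. - H h) = - strace H"
  by (simp add: strace_def sum_negf)

lemma normalized_quadratic_form:
  fixes g :: "'a::euclidean_space"
  assumes "linear H"
  shows "H ((1 / norm g) *\<^sub>R g) \<bullet> ((1 / norm g) *\<^sub>R g) = (H g \<bullet> g) / (norm g)\<^sup>2"
  using assms by (simp add: linear_cmul power2_eq_square)

lemma ls_supersol_imp_supersol_test:
  assumes "ls_supersol \<phi>"
  shows "supersol_test \<phi>"
  unfolding supersol_test_def
proof (intro allI impI)
  fix \<psi> U p d g H
  assume U: "open U" "p \<in> U" "U \<subseteq> UNIV \<times> {0<..}" and j: "jets U \<psi> d g H"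
    and le: "\<forall>q\<in>U. \<phi> p - \<psi> p \<le> \<phi> q - \<psi> q"
  note J = jets_imp_C21_on[OF j U(1)]
  have *: "if g p \<noteq> 0 then d p \<ge> strace (H p) - (H p (g p) \<bullet> g p) / (norm (g p))\<^sup>2
       else (\<exists>\<eta>. norm \<eta> \<le> 1 \<and> d p \<ge> strace (H p) - H p \<eta> \<bullet> \<eta>)"
    using assms[unfolded ls_supersol_def, rule_format, of U p \<psi>] U J(1) le
    unfolding J(2-4)[OF U(2)] by blast
  show "\<exists>n. norm n \<le> 1 \<and> (g p \<noteq> 0 \<longrightarrow> n = (1 / norm (g p)) *\<^sub>R g p) \<and>
             strace (H p) - H p n \<bullet> n \<le> d p"
  proof (cases "g p = 0")
    case False
    then show ?thesis
      using * normalized_quadratic_form[OF jets_linear[OF j U(2)], of "g p"]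
      by (intro exI[of _ "(1 / norm (g p)) *\<^sub>R g p"]) auto
  qed (use * in auto)
qed

lemma ls_subsol_imp_supersol_test:
  assumes "ls_subsol \<phi>"
  shows "supersol_test (\<lambda>p. - \<phi> p)"
  unfolding supersol_test_def
proof (intro allI impI)
  fix \<psi> U p d g H
  assume U: "open U" "p \<in> U" "U \<subseteq> UNIV \<times> {0<..}" and j: "jets U \<psi> d g H"
    and le: "\<forall>q\<in>U. - \<phi> p - \<psi> p \<le> - \<phi> q - \<psi> q"
  note J = jets_imp_C21_on[OF jets_uminus[OF j] U(1)]
  have le': "\<forall>q\<in>U. \<phi> q - (- \<psi> q) \<le> \<phi> p - (- \<psi> p)" using le by force
  have *: "if g p \<noteq> 0 then - d p \<le> - strace (H p) + (H p (g p) \<bullet> g p) / (norm (g p))\<^sup>2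
       else (\<exists>\<eta>. norm \<eta> \<le> 1 \<and> - d p \<le> - strace (H p) + H p \<eta> \<bullet> \<eta>)"
    using assms[unfolded ls_subsol_def, rule_format, of U p "\<lambda>p. - \<psi> p"] U J(1) le'
    unfolding J(2-4)[OF U(2)] by (auto simp: strace_uminus linear_neg[OF jets_linear[OF j U(2)]] split: if_splits)
  show "\<exists>n. norm n \<le> 1 \<and> (g p \<noteq> 0 \<longrightarrow> n = (1 / norm (g p)) *\<^sub>R g p) \<and>
             strace (H p) - H p n \<bullet> n \<le> d p"
  proof (cases "g p = 0")
    case False
    then show ?thesis
      using * normalized_quadratic_form[OF jets_linear[OF j U(2)], of "g p"]
      by (intro exI[of _ "(1 / norm (g p)) *\<^sub>R g p"]) auto
  next
    case True
    then obtain \<eta> where "norm \<eta> \<le> 1" "- d p \<le> - strace (H p) + H p \<eta> \<bullet> \<eta>" using * by auto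
    then show ?thesis using True by (intro exI[of _ \<eta>]) auto
  qed
qed

text \<open>Expanding the divergence, the derivative of \<open>1 / w\<close> with
  \<open>w = sqrt (1 + |g|^2)\<close> yields the rank-one correction. The result differs from the
  level set operator only by the 1 in the denominator.\<close>

lemma gmcf_at_jets:
  assumes j: "jets W u d g H" "open W" and p: "p \<in> W" and eq: "gmcf_at u p"
  shows "d p = strace (H p) - (H p (g p) \<bullet> g p) / (1 + (norm (g p))\<^sup>2)"
proof -
  note J = jets_imp_C21_on[OF j]
  define y t where "y = fst p" and "t = snd p"
  have p_eq: "p = (y, t)" by (simp add: y_def t_def)
  define w where "w = sqrt (1 + g p \<bullet> g p)"
  have w: "w > 0" "w\<^sup>2 = 1 + g p \<bullet> g p" by (auto simp: w_def add_pos_nonneg)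
  have lin: "linear (H p)" using jets_linear[OF j(1) p] .
  have dg: "((\<lambda>y. g (y, t)) has_derivative H p) (at y)"
    using j(1) p unfolding jets_def p_eq by auto
  define D where "D h = (1 / w) *\<^sub>R H p h - ((H p h \<bullet> g p) / w ^ 3) *\<^sub>R g p" for h
  have "((\<lambda>y. (1 / sqrt (1 + g (y, t) \<bullet> g (y, t))) *\<^sub>R g (y, t)) has_derivative D) (at y)"
  proof -
    have pos: "1 + g p \<bullet> g p > 0" by (simp add: add_pos_nonneg)
    have 1: "((\<lambda>y. 1 + g (y, t) \<bullet> g (y, t)) has_derivative (\<lambda>h. 2 * (H p h \<bullet> g p))) (at y)"
      by (rule derivative_eq_intros dg refl | simp add: p_eq inner_commute)+
    have 2: "((\<lambda>x. 1 / sqrt x) has_real_derivative (- 1 / (2 * w ^ 3))) (at (1 + g p \<bullet> g p))"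
      using pos w
      by (auto intro!: derivative_eq_intros simp: w_def[symmetric] field_simps power2_eq_square power3_eq_cube)
    have 3: "((\<lambda>y. 1 / sqrt (1 + g (y, t) \<bullet> g (y, t))) has_derivative
        (\<lambda>h. - (H p h \<bullet> g p) / w ^ 3)) (at y)"
      by (rule has_derivative_eq_rhs[OF DERIV_compose_FDERIV[OF _ 1]]) (use 2 in \<open>auto simp: p_eq\<close>)
    show ?thesis
      by (rule has_derivative_eq_rhs[OF has_derivative_scaleR[OF 3 dg]])
         (simp add: D_def fun_eq_iff p_eq w_def)
  qed
  then have "((\<lambda>y. (1 / sqrt (1 + (norm (sgrad u (y, t)))\<^sup>2)) *\<^sub>R sgrad u (y, t)) has_derivative D) (at y)"
    by (rule has_derivative_transform_within_open[OF _ open_time_slice[OF j(2), of t]])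
       (use p J(2) in \<open>auto simp: p_eq power2_norm_eq_inner\<close>)
  then have "frechet_derivative (\<lambda>y. (1 / sqrt (1 + (norm (sgrad u (y, t)))\<^sup>2)) *\<^sub>R sgrad u (y, t)) (at y) = D"
    by (rule frechet_derivative_at[symmetric])
  then have "tder u p = w * (\<Sum>b\<in>Basis. D b \<bullet> b)"
    using eq J(2)[OF p] unfolding gmcf_at_def sdiv_def w_def
    by (simp add: p_eq power2_norm_eq_inner)
  also have "(\<Sum>b\<in>Basis. D b \<bullet> b) = strace (H p) / w - (\<Sum>b\<in>Basis. (H p b \<bullet> g p) * (g p \<bullet> b)) / w ^ 3"
    by (simp add: D_def strace_def inner_diff_left sum_subtractf sum_divide_distrib)
  also have "(\<Sum>b\<in>Basis. (H p b \<bullet> g p) * (g p \<bullet> b)) = H p (\<Sum>b\<in>Basis. (g p \<bullet> b) *\<^sub>R b) \<bullet> g p"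
    by (simp add: linear_sum[OF lin] linear_cmul[OF lin] inner_sum_left mult.commute)
  also have "\<dots> = H p (g p) \<bullet> g p" by (simp add: euclidean_representation)
  also have "w * (strace (H p) / w - H p (g p) \<bullet> g p / w ^ 3) = strace (H p) - (H p (g p) \<bullet> g p) / w\<^sup>2"
    using w(1) by (simp add: right_diff_distrib power2_eq_square power3_eq_cube)
  finally have "tder u p = strace (H p) - (H p (g p) \<bullet> g p) / w\<^sup>2" .
  then show ?thesis using J(3)[OF p] w(2) by (simp add: power2_norm_eq_inner)
qed

section \<open>Second-order conditions and traces\<close>

text \<open>If \<open>H e \<bullet> e\<close> were negative, the slope \<open>j\<close> of
  \<open>F\<close> along \<open>y + s e\<close>, which is 0 at \<open>s = 0\<close>, would be
  negative just after 0, and the mean value theorem would push \<open>F\<close> below its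
  minimum.\<close>

lemma local_min_second_order:
  fixes F :: "'a::euclidean_space \<Rightarrow> real"
  assumes "open S" "y \<in> S"
    and F: "\<And>z. z \<in> S \<Longrightarrow> (F has_derivative (\<lambda>h. G z \<bullet> h)) (at z)"
    and G: "(G has_derivative H) (at y)"
    and min: "\<And>z. z \<in> S \<Longrightarrow> F y \<le> F z"
  shows "G y = 0" and "0 \<le> H e \<bullet> e"
proof -
  have "(\<lambda>h. G y \<bullet> h) = (\<lambda>h. 0)"
    using has_derivative_local_min[OF F[OF assms(2)]] eventually_at_topological min assms(1,2)
    by (metis (no_types, lifting))
  then have "G y \<bullet> G y = 0" by metis
  then show Gy: "G y = 0" by simp
  show "0 \<le> H e \<bullet> e"
  proof (rule ccontr)
    assume neg: "\<not> 0 \<le> H e \<bullet> e"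
    have "((\<lambda>s. y + s *\<^sub>R e) \<longlongrightarrow> y + 0 *\<^sub>R e) (at_right 0)" by (intro tendsto_intros)
    then have "\<forall>\<^sub>F s in at_right (0::real). y + s *\<^sub>R e \<in> S"
      using topological_tendstoD[OF _ assms(1)] assms(2) by fastforce
    then obtain c where c: "c > 0" "\<And>s. 0 < s \<Longrightarrow> s < c \<Longrightarrow> y + s *\<^sub>R e \<in> S"
      by (auto simp: eventually_at_right_field)
    define j where "j s = G (y + s *\<^sub>R e) \<bullet> e" for s
    have ln: "((\<lambda>s. y + s *\<^sub>R e) has_derivative (\<lambda>s. s *\<^sub>R e)) (at s)" for s
      by (auto intro!: derivative_eq_intros)
    have "((\<lambda>s. G (y + s *\<^sub>R e)) has_derivative (\<lambda>s. H (s *\<^sub>R e))) (at 0)"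
      by (rule has_derivative_compose[OF ln]) (use G in simp)
    then have "(j has_derivative (\<lambda>s. H (s *\<^sub>R e) \<bullet> e)) (at 0)"
      unfolding j_def by (rule has_derivative_inner_left)
    then have "(j has_real_derivative H e \<bullet> e) (at 0)"
      using has_derivative_linear[OF G]
      by (simp add: has_field_derivative_def linear_cmul mult_commute_abs)
    then obtain d where d: "d > 0" "\<And>s. 0 < s \<Longrightarrow> s < d \<Longrightarrow> j s < j 0"
      using DERIV_neg_dec_right[of j "H e \<bullet> e" 0] neg by auto
    define r where "r = min c d / 2"
    have r: "0 < r" "r < c" "r < d" using c(1) d(1) by (auto simp: r_def)
    have inS: "y + s *\<^sub>R e \<in> S" if "0 \<le> s" "s \<le> r" for s
      using c(2)[of s] that assms(2) r by (cases "s = 0") auto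
    have dF: "((\<lambda>s. F (y + s *\<^sub>R e)) has_real_derivative j s) (at s)" if "0 \<le> s" "s \<le> r" for s
      using has_derivative_compose[OF ln F[OF inS[OF that]]]
      by (simp add: has_field_derivative_def j_def mult_commute_abs)
    obtain s where s: "0 < s" "s < r" "F (y + r *\<^sub>R e) - F (y + 0 *\<^sub>R e) = (r - 0) * j s"
      using MVT2[of 0 r "\<lambda>s. F (y + s *\<^sub>R e)" j] r(1) dF by auto
    have "j s < 0" using d(2)[of s] s r by (simp add: j_def Gy)
    then have "F (y + r *\<^sub>R e) < F y" using s(3) mult_pos_neg[OF r(1), of "j s"] by simp
    then show False using min[OF inS[of r]] r by simp
  qed
qed

lemma strace_add: "strace (\<lambda>h. A h + B h) = strace A + strace B"
  by (simp add: strace_def inner_add_left sum.distrib)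

lemma strace_scaleR: "strace (\<lambda>h. c *\<^sub>R A h) = c * strace A"
  by (simp add: strace_def sum_distrib_left)

lemma strace_rank_one: "strace (\<lambda>h. (a \<bullet> h) *\<^sub>R b) = a \<bullet> b"
  by (simp add: strace_def euclidean_inner[of a b] inner_commute)

lemma strace_ident: "strace (\<lambda>h::'a::euclidean_space. h) = DIM('a)"
  by (simp add: strace_def)

text \<open>The left side is the trace of \<open>M Z M\<close> for the symmetric map
  \<open>M = id - c n n^T\<close>. The values used are \<open>c = 1\<close>, a projection when
  \<open>n\<close> is a unit vector, and \<open>c = 2\<close>, a reflection.\<close>

lemma sum_quadratic_rank_one_update:
  fixes Z :: "'a::euclidean_space \<Rightarrow> 'a"
  assumes "linear Z"
  shows "(\<Sum>b\<in>Basis. Z (b - (c * (n \<bullet> b)) *\<^sub>R n) \<bullet> (b - (c * (n \<bullet> b)) *\<^sub>R n))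
       = strace Z + (c\<^sup>2 * (n \<bullet> n) - 2 * c) * (Z n \<bullet> n)"
proof -
  have *: "Z (b - (c * (n \<bullet> b)) *\<^sub>R n) \<bullet> (b - (c * (n \<bullet> b)) *\<^sub>R n)
      = Z b \<bullet> b - c * ((n \<bullet> b) *\<^sub>R Z b \<bullet> n) - c * ((n \<bullet> b) * (Z n \<bullet> b))
        + (c\<^sup>2 * (Z n \<bullet> n)) * ((n \<bullet> b) * (n \<bullet> b))" for b
    using assms by (simp add: linear_diff linear_cmul inner_diff algebra_simps power2_eq_square)
  have "(\<Sum>b\<in>Basis. (n \<bullet> b) *\<^sub>R Z b \<bullet> n) = Z (\<Sum>b\<in>Basis. (n \<bullet> b) *\<^sub>R b) \<bullet> n"
    using assms by (simp add: linear_sum linear_cmul inner_sum_left)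
  then have "(\<Sum>b\<in>Basis. (n \<bullet> b) *\<^sub>R Z b \<bullet> n) = Z n \<bullet> n"
    by (simp add: euclidean_representation)
  moreover have "(\<Sum>b\<in>Basis. (n \<bullet> b) * (Z n \<bullet> b)) = Z n \<bullet> n"
    by (simp add: euclidean_inner[of "Z n" n] mult.commute)
  moreover have "(\<Sum>b\<in>Basis. (n \<bullet> b) * (n \<bullet> b)) = n \<bullet> n"
    by (simp add: euclidean_inner[of n n])
  ultimately show ?thesis
    unfolding * sum.distrib sum_subtractf sum_distrib_left[symmetric]
    by (simp add: strace_def algebra_simps)
qed

text \<open>With \<open>c = 1\<close> the trace above is a sum of nonnegative terms, and
  \<open>|n|^2 - 2 \<le> -1\<close>.\<close>

lemma quadratic_form_le_strace:
  fixes Z :: "'a::euclidean_space \<Rightarrow> 'a"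
  assumes "linear Z" and nonneg: "\<And>e. 0 \<le> Z e \<bullet> e" and "norm n \<le> 1"
  shows "Z n \<bullet> n \<le> strace Z"
proof -
  have "0 \<le> strace Z + (1\<^sup>2 * (n \<bullet> n) - 2 * 1) * (Z n \<bullet> n)"
    unfolding sum_quadratic_rank_one_update[OF assms(1), of 1 n, symmetric]
    by (intro sum_nonneg nonneg)
  moreover have "(n \<bullet> n) * (Z n \<bullet> n) \<le> 1 * (Z n \<bullet> n)"
    using assms(3) nonneg[of n] by (intro mult_right_mono) (auto simp: norm_le_square)
  ultimately show ?thesis by (simp add: algebra_simps)
qed

text \<open>For \<open>c = 2\<close> and a unit vector the coefficient
  \<open>c^2 |m|^2 - 2 c\<close> vanishes.\<close>

lemma strace_reflection:
  fixes Z :: "'a::euclidean_space \<Rightarrow> 'a"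
  assumes "linear Z" "m \<bullet> m = 1"
  defines "S \<equiv> \<lambda>h. h - (2 * (m \<bullet> h)) *\<^sub>R m"
  shows "strace (\<lambda>h. S (Z (S h))) = strace Z"
proof -
  have "S h \<bullet> k = h \<bullet> S k" for h k
    by (simp add: S_def inner_diff inner_commute)
  then show ?thesis
    using sum_quadratic_rank_one_update[OF assms(1), of 2 m] assms(2)
    unfolding strace_def by (simp add: S_def)
qed

text \<open>On \<open>y = Y x\<close>, where \<open>Y x0 = y0\<close>, the doubled inequality says
  that \<open>V\<close> minus the function given here is minimal at \<open>x0\<close>; this is the
  input to \<open>supersol_test\<close>. The derivative of \<open>z\<close> is
  \<open>id - B\<close>, and self-adjointness of \<open>B\<close> puts the gradient into the
  displayed form.\<close>

lemma jets_composed_test_function: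
  fixes u :: "'a::euclidean_space \<times> real \<Rightarrow> real" and x0 y0 :: 'a
  assumes j: "jets W u d g H" and "linear B" and adj: "\<And>h k. B h \<bullet> k = h \<bullet> B k"
    and f: "\<And>s. (f has_real_derivative f' s) (at s)"
    and f': "\<And>s. (f' has_real_derivative f'' s) (at s)" and f'': "continuous_on UNIV f''"
    and \<theta>W: "\<forall>t\<in>snd ` W. (\<theta> has_real_derivative \<theta>' t) (at t)"
    and \<theta>': "continuous_on (snd ` W) \<theta>'"
  defines "Y \<equiv> \<lambda>x. y0 + B (x - x0)" and "z \<equiv> \<lambda>x. x - (y0 + B (x - x0))"
  shows "jets {p. (Y (fst p), snd p) \<in> W}
    (\<lambda>p. - (\<theta> (snd p) + \<beta> * (fst p \<bullet> fst p) + K * (z (fst p) \<bullet> z (fst p))\<^sup>2 + f (u (Y (fst p), snd p))))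
    (\<lambda>p. - (\<theta>' (snd p) + f' (u (Y (fst p), snd p)) * d (Y (fst p), snd p)))
    (\<lambda>p. - ((2 * \<beta>) *\<^sub>R fst p + (4 * K * (z (fst p) \<bullet> z (fst p))) *\<^sub>R (z (fst p) - B (z (fst p)))
            + f' (u (Y (fst p), snd p)) *\<^sub>R B (g (Y (fst p), snd p))))
    (\<lambda>p h. - ((2 * \<beta>) *\<^sub>R h
            + ((8 * K * (z (fst p) \<bullet> (h - B h))) *\<^sub>R (z (fst p) - B (z (fst p)))
              + (4 * K * (z (fst p) \<bullet> z (fst p))) *\<^sub>R ((h - B h) - B (h - B h)))
            + ((f'' (u (Y (fst p), snd p)) * (g (Y (fst p), snd p) \<bullet> B h)) *\<^sub>R B (g (Y (fst p), snd p))
              + f' (u (Y (fst p), snd p)) *\<^sub>R B (H (Y (fst p), snd p) (B h)))))"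
proof -
  have J: "((\<lambda>y. u (y, t)) has_derivative (\<lambda>h. g (y, t) \<bullet> h)) (at y)"
       "((\<lambda>s. u (y, s)) has_real_derivative d (y, t)) (at t)"
       "((\<lambda>y. g (y, t)) has_derivative H (y, t)) (at y)" if "(y, t) \<in> W" for y t
    using j that unfolding jets_def by auto
  have Jc: "continuous_on W u" "continuous_on W d" "continuous_on W g" "\<And>h. continuous_on W (\<lambda>p. H p h)"
    using j unfolding jets_def by auto
  have \<theta>: "(\<theta> has_real_derivative \<theta>' t) (at t)" if "(y, t) \<in> W" for y t
    using \<theta>W that by force
  have bl: "bounded_linear B" using assms(2) by (simp add: linear_conv_bounded_linear)
  note dB = bounded_linear.has_derivative[OF bl]
  have cB: "continuous_on A (\<lambda>x. B (k x))" if "continuous_on A k" for A and k :: "'a \<times> real \<Rightarrow> 'a"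
    using bounded_linear.continuous_on[OF bl that] .
  let ?U = "{p. (Y (fst p), snd p) \<in> W}"
  have dY: "(Y has_derivative B) (at x)" for x
    unfolding Y_def by (rule derivative_eq_intros dB refl | simp)+
  have dz: "(z has_derivative (\<lambda>h. h - B h)) (at x)" for x
    unfolding z_def by (rule derivative_eq_intros dB refl | simp)+
  have cY: "continuous_on A (\<lambda>p. Y (fst p))" and cz: "continuous_on A (\<lambda>p. z (fst p))"
    for A :: "('a \<times> real) set"
    unfolding Y_def z_def by (intro continuous_intros cB)+
  have cW: "continuous_on ?U (\<lambda>p. k (Y (fst p), snd p))"
    if "continuous_on W k" for k :: "'a \<times> real \<Rightarrow> 'b::topological_space"
    by (rule continuous_on_compose2[OF that]) (auto intro!: continuous_intros cY)
  have cf: "continuous_on UNIV f" "continuous_on UNIV f'"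
    using f f' by (auto intro!: continuous_at_imp_continuous_on DERIV_isCont)
  have cfu: "continuous_on W (\<lambda>p. k (u p))" if "continuous_on UNIV k" for k :: "real \<Rightarrow> real"
    by (rule continuous_on_compose2[OF that Jc(1)]) auto
  have c\<theta>: "continuous_on (snd ` W) \<theta>"
    using \<theta> by (fastforce intro!: continuous_at_imp_continuous_on dest: DERIV_isCont)
  have ct: "continuous_on ?U (\<lambda>p. k (snd p))" if "continuous_on (snd ` W) k" for k :: "real \<Rightarrow> real"
    by (rule continuous_on_compose2[OF that]) (force intro!: continuous_intros)+
  have du: "((\<lambda>x. u (Y x, t)) has_derivative (\<lambda>h. g (Y x, t) \<bullet> B h)) (at x)" if "(Y x, t) \<in> W" for x t
    using has_derivative_compose[OF dY, of "\<lambda>y. u (y, t)"] J(1)[OF that] by blast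
  have dgY: "((\<lambda>x. g (Y x, t)) has_derivative (\<lambda>h. H (Y x, t) (B h))) (at x)" if "(Y x, t) \<in> W" for x t
    using has_derivative_compose[OF dY, of "\<lambda>y. g (y, t)"] J(3)[OF that] by blast
  have 1: "((\<lambda>x. - (\<theta> t + \<beta> * (x \<bullet> x) + K * (z x \<bullet> z x)\<^sup>2 + f (u (Y x, t))))
     has_derivative (\<lambda>h. - ((2 * \<beta>) *\<^sub>R x + (4 * K * (z x \<bullet> z x)) *\<^sub>R (z x - B (z x))
            + f' (u (Y x, t)) *\<^sub>R B (g (Y x, t))) \<bullet> h)) (at x)" if "(Y x, t) \<in> W" for x t
    by (rule derivative_eq_intros dz DERIV_compose_FDERIV[OF f du[OF that]] refl)+
      (simp add: fun_eq_iff inner_add_left inner_diff inner_left_distrib adj[symmetric]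
        algebra_simps inner_commute power2_eq_square)
  have 2: "((\<lambda>s. - (\<theta> s + \<beta> * (x \<bullet> x) + K * (z x \<bullet> z x)\<^sup>2 + f (u (Y x, s))))
     has_real_derivative - (\<theta>' t + f' (u (Y x, t)) * d (Y x, t))) (at t)" if "(Y x, t) \<in> W" for x t
    by (rule derivative_eq_intros \<theta>[OF that] DERIV_chain2[OF f J(2)[OF that]] refl | simp)+
  have 3: "((\<lambda>x. - ((2 * \<beta>) *\<^sub>R x + (4 * K * (z x \<bullet> z x)) *\<^sub>R (z x - B (z x))
            + f' (u (Y x, t)) *\<^sub>R B (g (Y x, t)))) has_derivative
       (\<lambda>h. - ((2 * \<beta>) *\<^sub>R h
            + ((8 * K * (z x \<bullet> (h - B h))) *\<^sub>R (z x - B (z x))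
              + (4 * K * (z x \<bullet> z x)) *\<^sub>R ((h - B h) - B (h - B h)))
            + ((f'' (u (Y x, t)) * (g (Y x, t) \<bullet> B h)) *\<^sub>R B (g (Y x, t))
              + f' (u (Y x, t)) *\<^sub>R B (H (Y x, t) (B h)))))) (at x)" if "(Y x, t) \<in> W" for x t
    by (rule derivative_eq_intros dz dB[OF dz] DERIV_compose_FDERIV[OF f' du[OF that]] dB[OF dgY[OF that]] refl)+
      (simp add: fun_eq_iff inner_commute algebra_simps)
  show ?thesis
    unfolding jets_def
    by (intro conjI allI impI; (simp del: minus_add_distrib add: 1 2 3)?)
      (auto intro!: continuous_intros cY cz cB cW Jc cfu[OF cf(1)] cfu[OF cf(2)] cfu[OF f''] ct[OF c\<theta>] ct[OF \<theta>'])
qed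

section \<open>Estimates at an interior minimum\<close>

lemma norm_diff_normalized_le:
  fixes p q :: "'a::real_inner"
  assumes "p \<noteq> 0" "q \<noteq> 0"
  shows "norm ((1 / norm p) *\<^sub>R p - (1 / norm q) *\<^sub>R q) \<le> 2 * norm (p - q) / norm q"
proof -
  have "(1 / norm p) *\<^sub>R p - (1 / norm q) *\<^sub>R q
      = (1 / norm p - 1 / norm q) *\<^sub>R p + (1 / norm q) *\<^sub>R (p - q)"
    by (simp add: algebra_simps)
  also have "norm \<dots> \<le> norm ((1 / norm p - 1 / norm q) *\<^sub>R p) + norm ((1 / norm q) *\<^sub>R (p - q))"
    by (rule norm_triangle_ineq)
  also have "norm ((1 / norm p - 1 / norm q) *\<^sub>R p) = \<bar>(1 / norm p - 1 / norm q) * norm p\<bar>"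
    by (simp add: abs_mult)
  also have "(1 / norm p - 1 / norm q) * norm p = (norm q - norm p) / norm q"
    using assms by (simp add: field_simps)
  also have "\<bar>(norm q - norm p) / norm q\<bar> \<le> norm (p - q) / norm q"
    using norm_triangle_ineq3[of q p] by (simp add: divide_right_mono norm_minus_commute)
  finally show ?thesis by (simp add: add_divide_distrib[symmetric] divide_right_mono)
qed

text \<open>The mirror normal is the bisector \<open>P + Q\<close>, of length \<open>s\<close>, and
  not \<open>P - Q\<close>. It does not degenerate for \<open>P = Q\<close>, and it is close to
  \<open>P\<close>, with \<open>1 - (m \<bullet> P)^2 = |P - Q|^2 / 4\<close>. This factor later
  multiplies the Hessian of the penalty. The sign in \<open>- Q\<close> is harmless, as the
  operators are even in the direction.\<close>

lemma obtain_reflection: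
  fixes p q :: "'a::real_inner"
  assumes "p \<bullet> q > 0"
  defines "P \<equiv> (1 / norm p) *\<^sub>R p" and "Q \<equiv> (1 / norm q) *\<^sub>R q"
  obtains m where "m \<bullet> m = 1" "P - (2 * (m \<bullet> P)) *\<^sub>R m = - Q"
    "1 - (m \<bullet> P)\<^sup>2 \<le> (norm (p - q) / norm q)\<^sup>2"
proof -
  have nz: "p \<noteq> 0" "q \<noteq> 0" using assms by auto
  have PP: "P \<bullet> P = 1" and QQ: "Q \<bullet> Q = 1"
    using nz by (auto simp: P_def Q_def dot_square_norm power2_eq_square)
  define c where "c = P \<bullet> Q"
  have c: "c > 0" using assms(1) nz by (simp add: c_def P_def Q_def)
  define s where "s = sqrt (2 + 2 * c)"
  have s: "s > 0" "s\<^sup>2 = 2 + 2 * c" using c by (auto simp: s_def)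
  define m where "m = (1 / s) *\<^sub>R (P + Q)"
  have mP: "m \<bullet> P = s / 2"
  proof -
    have "m \<bullet> P = (1 + c) / s" using PP by (simp add: m_def c_def inner_add_left inner_commute[of Q])
    also have "\<dots> = s / 2" using s by (simp add: field_simps power2_eq_square)
    finally show ?thesis .
  qed
  show thesis
  proof (rule that)
    have "m \<bullet> m = (2 + 2 * c) / s\<^sup>2"
      using PP QQ by (simp add: m_def c_def inner_add_left inner_add_right inner_commute power2_eq_square)
    then show "m \<bullet> m = 1" using s c by simp
    have "(2 * (m \<bullet> P)) *\<^sub>R m = P + Q" unfolding mP using s(1) by (simp add: m_def)
    then show "P - (2 * (m \<bullet> P)) *\<^sub>R m = - Q" by simp
    have "norm (P - Q) \<le> 2 * (norm (p - q) / norm q)"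
      using norm_diff_normalized_le[OF nz] by (simp add: P_def Q_def)
    then have "(norm (P - Q))\<^sup>2 \<le> (2 * (norm (p - q) / norm q))\<^sup>2" by (intro power_mono) auto
    moreover have "(norm (P - Q))\<^sup>2 = 2 - 2 * c"
      using PP QQ by (simp add: power2_norm_eq_inner c_def inner_diff inner_commute)
    moreover have "1 - (m \<bullet> P)\<^sup>2 = (2 - 2 * c) / 4" unfolding mP using s(2) by (simp add: power_divide field_simps)
    ultimately show "1 - (m \<bullet> P)\<^sup>2 \<le> (norm (p - q) / norm q)\<^sup>2" unfolding power_mult_distrib by simp
  qed
qed

text \<open>The bounds complement each other. \<open>K * A\<close> measures the Hessian of the
  penalty and \<open>Q\<close> is the norm of its gradient. The first bound serves when
  \<open>K * A\<close> is small; in the second, \<open>K * A\<close> appears only with the square of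
  a ratio to \<open>Q\<close>, small once \<open>Q\<close> dominates
  \<open>2 * \<beta> * norm x0\<close> and \<open>f'\<close>.\<close>

lemma interior_minimum_estimates:
  fixes V u :: "'a::euclidean_space \<times> real \<Rightarrow> real" and x0 y0 :: 'a and A Q \<beta> K t0 :: real
  assumes V: "supersol_test V" and W: "open W" "W \<subseteq> UNIV \<times> {0<..}"
    and u: "gmcf_classical W u" and inW: "(y0, t0) \<in> W"
    and f: "\<And>s. (f has_real_derivative f' s) (at s)"
    and f': "\<And>s. (f' has_real_derivative f'' s) (at s)" and f'': "continuous_on UNIV f''" "\<And>s. 0 \<le> f'' s"
    and \<theta>: "\<forall>t\<in>snd ` W. (\<theta> has_real_derivative \<theta>' t) (at t)"
    and \<theta>': "continuous_on (snd ` W) \<theta>'"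
    and "0 \<le> \<beta>" "0 \<le> K"
    and min: "\<forall>x y t. (y, t) \<in> W \<longrightarrow>
      V (x0, t0) + \<theta> t0 + \<beta> * (x0 \<bullet> x0) + K * ((x0 - y0) \<bullet> (x0 - y0))\<^sup>2 + f (u (y0, t0))
       \<le> V (x, t) + \<theta> t + \<beta> * (x \<bullet> x) + K * ((x - y) \<bullet> (x - y))\<^sup>2 + f (u (y, t))"
  defines "A \<equiv> (x0 - y0) \<bullet> (x0 - y0)"
  defines "Q \<equiv> 4 * K * A * norm (x0 - y0)"
  shows "\<theta>' t0 \<le> 2 * \<beta> * real DIM('a) + (16 + 8 * real DIM('a)) * (K * A) + f'' (u (y0, t0))"
    and "2 * \<beta> * norm x0 < Q \<Longrightarrow>
      \<theta>' t0 \<le> 2 * \<beta> * real DIM('a) + 48 * (K * A) * (2 * \<beta> * norm x0 / Q)\<^sup>2 + f'' (u (y0, t0))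
        + 12 * (K * A) * (f' (u (y0, t0)) / Q)\<^sup>2"
proof -
  define a where "a = x0 - y0"
  define g where "g = sgrad u (y0, t0)"
  define H where "H = shess u (y0, t0)"
  define d where "d = tder u (y0, t0)"
  define c1 where "c1 = f' (u (y0, t0))"
  define c2 where "c2 = f'' (u (y0, t0))"
  define N where "N = real DIM('a)"
  have A: "a \<bullet> a = A" by (simp add: A_def a_def)
  have A0: "A \<ge> 0" by (simp add: A_def)
  have c2: "c2 \<ge> 0" by (simp add: c2_def f'')
  have j: "jets W u (tder u) (sgrad u) (shess u)"
    using u C21_on_imp_jets unfolding gmcf_classical_def by blast
  have lin: "linear H" using jets_linear[OF j inW] by (simp add: H_def)
  have d: "d = strace H - (H g \<bullet> g) / (1 + g \<bullet> g)"
    using gmcf_at_jets[OF j W(1) inW] u inW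
    unfolding gmcf_classical_def d_def H_def g_def power2_norm_eq_inner by blast
  \<comment> \<open>\<open>q\<close> is the gradient of the penalty in \<open>x\<close>, and minus
    its gradient in \<open>y\<close>; stationarity in \<open>y\<close> thus reads
    \<open>c1 g = q\<close>. \<open>Z\<close> is the Hessian in \<open>y\<close> of the penalty plus
    \<open>f\<close> of \<open>u\<close>.\<close>
  define q where "q = (4 * K * A) *\<^sub>R a"
  define Z where "Z h = ((8 * K * (a \<bullet> h)) *\<^sub>R a + (4 * K * A) *\<^sub>R h) + ((c2 * (g \<bullet> h)) *\<^sub>R g + c1 *\<^sub>R H h)" for h
  have second: "c1 *\<^sub>R g = q \<and> 0 \<le> Z e \<bullet> e" for e
  proof -
    define S where "S = {y. (y, t0) \<in> W}"
    have S: "open S" "y0 \<in> S" using open_time_slice[OF W(1)] inW by (auto simp: S_def)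
    define F where "F y = K * ((x0 - y) \<bullet> (x0 - y))\<^sup>2 + f (u (y, t0))" for y
    define G where "G y = f' (u (y, t0)) *\<^sub>R sgrad u (y, t0) - (4 * K * ((x0 - y) \<bullet> (x0 - y))) *\<^sub>R (x0 - y)" for y
    have du: "((\<lambda>y. u (y, t0)) has_derivative (\<lambda>h. sgrad u (y, t0) \<bullet> h)) (at y)"
      and dg: "((\<lambda>y. sgrad u (y, t0)) has_derivative shess u (y, t0)) (at y)" if "y \<in> S" for y
      using j that unfolding jets_def S_def by auto
    have 1: "(F has_derivative (\<lambda>h. G z \<bullet> h)) (at z)" if "z \<in> S" for z
      unfolding F_def[abs_def]
      by (rule derivative_eq_intros DERIV_compose_FDERIV[OF f du[OF that]] refl)+
        (simp add: fun_eq_iff G_def inner_diff algebra_simps inner_commute power2_eq_square)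
    have 2: "(G has_derivative Z) (at y0)"
      unfolding G_def[abs_def]
      by (rule derivative_eq_intros DERIV_compose_FDERIV[OF f' du[OF S(2)]] dg[OF S(2)] refl)+
        (simp add: fun_eq_iff Z_def a_def A_def c1_def c2_def g_def H_def algebra_simps inner_commute)
    have 3: "F y0 \<le> F z" if "z \<in> S" for z
      using min[rule_format, of z t0 x0] that by (simp add: F_def S_def)
    have "G y0 = 0" "0 \<le> Z e \<bullet> e"
      using local_min_second_order[OF S 1 2 3] by auto
    then show ?thesis by (simp add: G_def q_def a_def A_def c1_def g_def)
  qed
  then have q: "c1 *\<^sub>R g = q" by blast

  define p where "p = (2 * \<beta>) *\<^sub>R x0 + q"
  \<comment> \<open>For every \<open>B\<close> the gradient of the test function at
    \<open>x0\<close> is \<open>- p\<close>: since \<open>c1 B g = B q\<close>, the contributions of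
    \<open>B\<close> cancel. Only the Hessian \<open>X\<close> depends on \<open>B\<close>.\<close>
  have test: "\<exists>n. norm n \<le> 1 \<and> (p \<noteq> 0 \<longrightarrow> n = - ((1 / norm p) *\<^sub>R p)) \<and>
      strace X - X n \<bullet> n \<le> - (\<theta>' t0 + c1 * d)"
    if B: "linear B" "\<And>h k. B h \<bullet> k = h \<bullet> B k"
      and X: "\<And>h. X h = - ((2 * \<beta>) *\<^sub>R h
            + ((8 * K * (a \<bullet> (h - B h))) *\<^sub>R (a - B a) + (4 * K * A) *\<^sub>R ((h - B h) - B (h - B h)))
            + ((c2 * (g \<bullet> B h)) *\<^sub>R B g + c1 *\<^sub>R B (H (B h))))"
    for B X :: "'a \<Rightarrow> 'a"
  proof -
    note J = jets_composed_test_function[OF j B f f' f''(1) \<theta> \<theta>', where ?y0.0 = y0 and ?x0.0 = x0 and \<beta> = \<beta> and K = K]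
    have X': "X = (\<lambda>h. - ((2 * \<beta>) *\<^sub>R h
            + ((8 * K * (a \<bullet> (h - B h))) *\<^sub>R (a - B a) + (4 * K * A) *\<^sub>R ((h - B h) - B (h - B h)))
            + ((c2 * (g \<bullet> B h)) *\<^sub>R B g + c1 *\<^sub>R B (H (B h)))))"
      using X by blast
    have B0: "B 0 = 0" using B(1) by (rule linear_0)
    have "c1 *\<^sub>R B g = B q" using q linear_cmul[OF B(1)] by metis
    then have Bq: "(2 * \<beta>) *\<^sub>R x0 + (4 * K * A) *\<^sub>R (a - B a) + c1 *\<^sub>R B g = p"
      using B(1) by (simp add: p_def q_def linear_cmul algebra_simps)
    have "continuous_on UNIV (\<lambda>p. (y0 + B (fst p - x0), snd p :: real))"
      using B(1) by (intro continuous_intros linear_continuous_on_compose[of _ _ B]) auto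
    then have "open ((\<lambda>p. (y0 + B (fst p - x0), snd p)) -` W)" using W(1) by (rule open_vimage[rotated])
    then have "open {p. (y0 + B (fst p - x0), snd p) \<in> W}" by (simp add: vimage_def)
    moreover have "(x0, t0) \<in> {p. (y0 + B (fst p - x0), snd p) \<in> W}" using inW B0 by simp
    moreover have "{p. (y0 + B (fst p - x0), snd p) \<in> W} \<subseteq> UNIV \<times> {0<..}" using W(2) by auto
    ultimately have "open {p. (y0 + B (fst p - x0), snd p) \<in> W}"
      "(x0, t0) \<in> {p. (y0 + B (fst p - x0), snd p) \<in> W}"
      "{p. (y0 + B (fst p - x0), snd p) \<in> W} \<subseteq> UNIV \<times> {0<..}" by blast+
    note R = V[unfolded supersol_test_def, rule_format, OF this J, unfolded fst_conv snd_conv diff_self B0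
        add_0_right a_def[symmetric] A Bq X'[symmetric] X[symmetric] c1_def[symmetric] c2_def[symmetric]
        g_def[symmetric] H_def[symmetric] d_def[symmetric]]
    have "\<exists>n. norm n \<le> 1 \<and> (- p \<noteq> 0 \<longrightarrow> n = (1 / norm (- p)) *\<^sub>R (- p)) \<and>
          strace X - X n \<bullet> n \<le> - (\<theta>' t0 + c1 * d)"
    proof (rule R)
      fix r assume "r \<in> {p. (y0 + B (fst p - x0), snd p) \<in> W}"
      then show "V (x0, t0) - - (\<theta> t0 + \<beta> * (x0 \<bullet> x0) + K * A\<^sup>2 + f (u (y0, t0)))
        \<le> V r - - (\<theta> (snd r) + \<beta> * (fst r \<bullet> fst r) + K * ((fst r - (y0 + B (fst r - x0))) \<bullet> (fst r - (y0 + B (fst r - x0))))\<^sup>2 + f (u (y0 + B (fst r - x0), snd r)))"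
        using min[rule_format, of "y0 + B (fst r - x0)" "snd r" "fst r"] by (simp add: A_def)
    qed
    then obtain n where "norm n \<le> 1" "- p \<noteq> 0 \<longrightarrow> n = (1 / norm (- p)) *\<^sub>R (- p)"
      "strace X - X n \<bullet> n \<le> - (\<theta>' t0 + c1 * d)" by blast
    then show ?thesis by (intro exI[of _ n]) auto
  qed
  have Zlin: "linear Z"
    unfolding Z_def using lin by (intro linearI) (auto simp: linear_add linear_cmul inner_add_right algebra_simps)
  have Zg: "Z g \<bullet> g = 8 * K * (a \<bullet> g)\<^sup>2 + 4 * K * A * (g \<bullet> g) + c2 * (g \<bullet> g)\<^sup>2 + c1 * (H g \<bullet> g)"
    by (simp add: Z_def inner_add_left power2_eq_square algebra_simps)
  have CS: "(a \<bullet> e)\<^sup>2 \<le> A * (e \<bullet> e)" for e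
    using Cauchy_Schwarz_ineq[of a e] by (simp add: A)
  have KA: "0 \<le> K * A" using \<open>0 \<le> K\<close> A0 by simp
  show "\<theta>' t0 \<le> 2 * \<beta> * real DIM('a) + (16 + 8 * real DIM('a)) * (K * A) + f'' (u (y0, t0))"
  proof -
    \<comment> \<open>\<open>B = 0\<close>: the spatial test function does not involve \<open>u\<close>, so this also covers a vanishing
      gradient; \<open>u\<close> enters only through its time derivative, bounded by the trace of \<open>Z\<close>.\<close>
    obtain n where n: "norm n \<le> 1" and ineq:
      "strace (\<lambda>h. - ((2 * \<beta>) *\<^sub>R h + ((8 * K) *\<^sub>R ((a \<bullet> h) *\<^sub>R a) + (4 * K * A) *\<^sub>R h)))
         + ((2 * \<beta>) * (n \<bullet> n) + 8 * K * (a \<bullet> n)\<^sup>2 + (4 * K * A) * (n \<bullet> n))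
        \<le> - (\<theta>' t0 + c1 * d)"
      using test[of "\<lambda>_. 0" "\<lambda>h. - ((2 * \<beta>) *\<^sub>R h + ((8 * K) *\<^sub>R ((a \<bullet> h) *\<^sub>R a) + (4 * K * A) *\<^sub>R h))"]
      by (force simp: linear_iff inner_add_left power2_eq_square inner_diff algebra_simps)
    have "0 \<le> (2 * \<beta>) * (n \<bullet> n) + 8 * K * (a \<bullet> n)\<^sup>2 + (4 * K * A) * (n \<bullet> n)"
      using \<open>0 \<le> \<beta>\<close> \<open>0 \<le> K\<close> A0 by simp
    with ineq have 1: "\<theta>' t0 + c1 * d \<le> 2 * \<beta> * N + (8 + 4 * N) * (K * A)"
      unfolding strace_uminus strace_add strace_scaleR strace_ident strace_rank_one A
      by (simp add: N_def algebra_simps)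
    \<comment> \<open>\<open>g\<close> is shortened so that \<open>Z w \<bullet> w\<close> carries
      exactly the denominator of the graphical equation;
      \<open>Z w \<bullet> w \<le> strace Z\<close> then bounds \<open>- c1 * d\<close>.\<close>
    define w where "w = (1 / sqrt (1 + g \<bullet> g)) *\<^sub>R g"
    have pos: "1 + g \<bullet> g > 0" by (simp add: add_pos_nonneg)
    have "norm w \<le> 1"
    proof -
      have "norm g \<le> sqrt (1 + g \<bullet> g)" by (simp add: norm_eq_sqrt_inner)
      then show ?thesis using pos by (simp add: w_def divide_le_eq)
    qed
    then have "Z w \<bullet> w \<le> strace Z" using second by (intro quadratic_form_le_strace Zlin) auto
    moreover have "Z w \<bullet> w = (Z g \<bullet> g) / (1 + g \<bullet> g)"
      using pos by (simp add: w_def linear_cmul[OF Zlin])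
    moreover have "strace Z = (8 + 4 * N) * (K * A) + c2 * (g \<bullet> g) + c1 * strace H"
    proof -
      have "Z = (\<lambda>h. ((8 * K) *\<^sub>R ((a \<bullet> h) *\<^sub>R a) + (4 * K * A) *\<^sub>R h) + (c2 *\<^sub>R ((g \<bullet> h) *\<^sub>R g) + c1 *\<^sub>R H h))"
        by (simp add: Z_def fun_eq_iff)
      then show ?thesis
        by (simp only: strace_add strace_scaleR strace_ident strace_rank_one A)
          (simp add: N_def algebra_simps)
    qed
    moreover have "(c2 * (g \<bullet> g)\<^sup>2 + c1 * (H g \<bullet> g)) / (1 + g \<bullet> g) \<le> (Z g \<bullet> g) / (1 + g \<bullet> g)"
      using pos \<open>0 \<le> K\<close> A0 by (intro divide_right_mono) (auto simp: Zg)
    ultimately have 2: "(c2 * (g \<bullet> g)\<^sup>2 + c1 * (H g \<bullet> g)) / (1 + g \<bullet> g)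
        \<le> (8 + 4 * N) * (K * A) + c2 * (g \<bullet> g) + c1 * strace H" by linarith
    \<comment> \<open>The rank-one part of \<open>Z\<close> could contribute
      \<open>c2 |g|^2\<close>, but its trace and its value at \<open>w\<close> nearly cancel,
      leaving at most \<open>c2\<close> however steep \<open>u\<close> is.\<close>
    have "c2 * (g \<bullet> g) - c2 * (g \<bullet> g)\<^sup>2 / (1 + g \<bullet> g) = c2 * ((g \<bullet> g) / (1 + g \<bullet> g))"
      using pos by (simp add: field_simps power2_eq_square)
    also have "\<dots> \<le> c2 * 1" using pos c2 by (intro mult_left_mono) auto
    finally have "- (c1 * d) \<le> (8 + 4 * N) * (K * A) + c2"
      using 2 unfolding d by (simp add: add_divide_distrib right_diff_distrib)
    with 1 show ?thesis by (simp add: N_def c2_def algebra_simps)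
  qed
  show "\<theta>' t0 \<le> 2 * \<beta> * real DIM('a) + 48 * (K * A) * (2 * \<beta> * norm x0 / Q)\<^sup>2 + f'' (u (y0, t0))
        + 12 * (K * A) * (f' (u (y0, t0)) / Q)\<^sup>2" if less: "2 * \<beta> * norm x0 < Q"
  proof -
    have nq: "norm q = Q" using \<open>0 \<le> K\<close> A0 by (simp add: q_def Q_def a_def)
    have Q: "Q > 0" using less \<open>0 \<le> \<beta>\<close> by (smt (verit) mult_nonneg_nonneg norm_ge_zero)
    then have q0: "q \<noteq> 0" using nq by auto
    \<comment> \<open>The assumption says \<open>|p - q| < |q|\<close>; this keeps \<open>p\<close>
      on the side of \<open>q\<close> and away from 0.\<close>
    have "\<bar>(2 * \<beta>) *\<^sub>R x0 \<bullet> q\<bar> \<le> norm ((2 * \<beta>) *\<^sub>R x0) * norm q" by (rule Cauchy_Schwarz_ineq2)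
    also have "\<dots> < norm q * norm q" using less \<open>0 \<le> \<beta>\<close> q0 by (simp add: nq Q)
    finally have pq: "p \<bullet> q > 0"
      by (simp add: p_def inner_add_left dot_square_norm power2_eq_square abs_less_iff)
    then have p0: "p \<noteq> 0" by auto
    define P where "P = (1 / norm p) *\<^sub>R p"
    define e where "e = (1 / norm q) *\<^sub>R q"
    \<comment> \<open>The reflection is close to the identity on the hyperplane orthogonal to \<open>P\<close>, which is all
      that the operator sees, although it maps \<open>P\<close> itself to \<open>- e\<close>.\<close>
    obtain m where m: "m \<bullet> m = 1" "P - (2 * (m \<bullet> P)) *\<^sub>R m = - e"
      and mP: "1 - (m \<bullet> P)\<^sup>2 \<le> (norm (p - q) / norm q)\<^sup>2"
      using obtain_reflection[OF pq] unfolding P_def e_def by blast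
    define B where "B h = h - (2 * (m \<bullet> h)) *\<^sub>R m" for h
    have Blin: "linear B" unfolding B_def by (intro linearI) (auto simp: inner_add_right algebra_simps)
    have Badj: "B h \<bullet> k = h \<bullet> B k" for h k by (simp add: B_def inner_diff inner_commute)
    have BB: "B (B h) = h" for h using m(1) by (simp add: B_def inner_diff algebra_simps)
    have BP: "B P = - e" using m(2) by (simp add: B_def)
    have PP: "P \<bullet> P = 1" using p0 by (simp add: P_def dot_square_norm power2_eq_square)
    \<comment> \<open>Since \<open>id - B = 2 m m^T\<close>, the Hessian of the penalty along
      \<open>x - Y x\<close> is \<open>c0 m m^T\<close>. Subtracting its value in the direction
      \<open>P\<close> from its trace leaves \<open>c0 * (1 - (m \<bullet> P)^2)\<close>.\<close>
    define c0 where "c0 = 32 * K * (a \<bullet> m)\<^sup>2 + 16 * K * A"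
    define X where "X h = - ((2 * \<beta>) *\<^sub>R h + c0 *\<^sub>R ((m \<bullet> h) *\<^sub>R m)
       + (c2 *\<^sub>R ((B g \<bullet> h) *\<^sub>R B g) + c1 *\<^sub>R B (H (B h))))" for h
    have hB: "h - B h = (2 * (m \<bullet> h)) *\<^sub>R m" for h by (simp add: B_def)
    have hBB: "(h - B h) - B (h - B h) = (4 * (m \<bullet> h)) *\<^sub>R m" for h
      unfolding hB using m(1) by (simp add: B_def algebra_simps)
    have Xeq: "X h = - ((2 * \<beta>) *\<^sub>R h
            + ((8 * K * (a \<bullet> (h - B h))) *\<^sub>R (a - B a) + (4 * K * A) *\<^sub>R ((h - B h) - B (h - B h)))
            + ((c2 * (g \<bullet> B h)) *\<^sub>R B g + c1 *\<^sub>R B (H (B h))))" for h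
    proof -
      have "(8 * K * (a \<bullet> ((2 * (m \<bullet> h)) *\<^sub>R m))) *\<^sub>R ((2 * (m \<bullet> a)) *\<^sub>R m) + (4 * K * A) *\<^sub>R ((4 * (m \<bullet> h)) *\<^sub>R m)
          = c0 *\<^sub>R ((m \<bullet> h) *\<^sub>R m)"
        unfolding scaleR_scaleR scaleR_add_left[symmetric]
        by (rule arg_cong[where f = "\<lambda>c. c *\<^sub>R m"])
          (simp add: c0_def inner_commute[of m a] power2_eq_square algebra_simps)
      then show ?thesis unfolding hBB unfolding hB X_def by (simp add: Badj)
    qed
    obtain n where n: "n = - P" "strace X - X n \<bullet> n \<le> - (\<theta>' t0 + c1 * d)"
      using test[OF Blin Badj Xeq] p0 unfolding P_def by blast
    have trX: "strace X = - (2 * \<beta> * N + c0 + (c2 * (g \<bullet> g) + c1 * strace H))"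
    proof -
      have "strace (\<lambda>h. B (H (B h))) = strace H"
        unfolding B_def[abs_def] by (rule strace_reflection[OF lin m(1)])
      moreover have "B g \<bullet> B g = g \<bullet> g" by (simp add: Badj BB)
      ultimately show ?thesis
        unfolding X_def[abs_def] strace_uminus strace_add strace_scaleR strace_ident strace_rank_one
        using m(1) by (simp add: N_def)
    qed
    have eg: "(g \<bullet> e)\<^sup>2 = g \<bullet> g" and He: "H e \<bullet> e = (H g \<bullet> g) / (g \<bullet> g)" and gQ: "c1\<^sup>2 * (g \<bullet> g) = Q\<^sup>2" and g0: "g \<noteq> 0" "c1 \<noteq> 0"
    proof -
      show g0: "g \<noteq> 0" "c1 \<noteq> 0" using q q0 by auto
      have e: "e = (sgn c1 / norm g) *\<^sub>R g"
        unfolding e_def q[symmetric] using g0 by (simp add: sgn_real_def divide_simps)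
      show "(g \<bullet> e)\<^sup>2 = g \<bullet> g" "H e \<bullet> e = (H g \<bullet> g) / (g \<bullet> g)"
        unfolding e using g0 by (auto simp: linear_cmul[OF lin] sgn_real_def dot_square_norm power2_eq_square)
      have "Q\<^sup>2 = q \<bullet> q" by (simp add: nq[symmetric] power2_norm_eq_inner)
      then show "c1\<^sup>2 * (g \<bullet> g) = Q\<^sup>2" unfolding q[symmetric] by (simp add: power2_eq_square)
    qed
    \<comment> \<open>\<open>B n = e\<close> is parallel to \<open>g\<close>, so the
      \<open>c2\<close> part here equals its trace and drops out of the inequality, while
      \<open>H\<close> enters as \<open>strace H - H e \<bullet> e\<close>, the level set operator
      applied to \<open>u\<close>.\<close>
    have XP: "X n \<bullet> n = - (2 * \<beta> + c0 * (m \<bullet> P)\<^sup>2 + (c2 * (g \<bullet> g) + c1 * ((H g \<bullet> g) / (g \<bullet> g))))"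
    proof -
      have Bn: "B n = e" using BP Blin by (simp add: n(1) linear_neg)
      have "X n \<bullet> n = - (2 * \<beta> * (n \<bullet> n) + c0 * (m \<bullet> n)\<^sup>2 + (c2 * (g \<bullet> B n)\<^sup>2 + c1 * (H (B n) \<bullet> B n)))"
        by (simp add: X_def inner_add_left Badj power2_eq_square algebra_simps)
      then show ?thesis unfolding Bn eg He by (simp add: n(1) PP)
    qed
    have 1: "\<theta>' t0 \<le> 2 * \<beta> * N + c0 * (1 - (m \<bullet> P)\<^sup>2) + c1 * (strace H - (H g \<bullet> g) / (g \<bullet> g) - d)"
      using n(2) \<open>0 \<le> \<beta>\<close> unfolding trX XP by (simp add: algebra_simps)
    have G: "g \<bullet> g > 0" using g0 by simp
    have c0: "c0 \<le> 48 * (K * A)"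
      using mult_left_mono[OF CS[of m] \<open>0 \<le> K\<close>] by (simp add: c0_def m(1) mult.commute[of A K])
    have "c0 * (1 - (m \<bullet> P)\<^sup>2) \<le> c0 * (norm (p - q) / norm q)\<^sup>2"
      using mP \<open>0 \<le> K\<close> A0 by (intro mult_left_mono) (auto simp: c0_def)
    also have "\<dots> \<le> 48 * (K * A) * (norm (p - q) / norm q)\<^sup>2"
      by (intro mult_right_mono c0) auto
    also have "norm (p - q) / norm q = 2 * \<beta> * norm x0 / Q"
      using \<open>0 \<le> \<beta>\<close> by (simp add: p_def nq)
    finally have 2: "c0 * (1 - (m \<bullet> P)\<^sup>2) \<le> 48 * (K * A) * (2 * \<beta> * norm x0 / Q)\<^sup>2" .
    have "0 \<le> Z g \<bullet> g" using second by blast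
    moreover have "8 * K * (a \<bullet> g)\<^sup>2 \<le> 8 * (K * A) * (g \<bullet> g)"
      using mult_left_mono[OF CS[of g] \<open>0 \<le> K\<close>] by simp
    ultimately have Hg: "- (c1 * (H g \<bullet> g)) \<le> (12 * (K * A) + c2 * (g \<bullet> g)) * (g \<bullet> g)"
      unfolding Zg by (simp add: algebra_simps power2_eq_square)
    \<comment> \<open>This is the remaining mismatch of \<open>1 / |g|^2\<close> and
      \<open>1 / (1 + |g|^2)\<close>. The condition \<open>0 \<le> Z g \<bullet> g\<close> bounds it
      from above although \<open>H\<close> itself is not bounded; 12 is the sum of the coefficients
      8 and 4 of the penalty in \<open>Z\<close>.\<close>
    have "c1 * (strace H - (H g \<bullet> g) / (g \<bullet> g) - d) = - (c1 * (H g \<bullet> g)) / ((g \<bullet> g) * (1 + g \<bullet> g))"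
    proof -
      have *: "c1 * (s - x / y - (s - x / (1 + y))) = - (c1 * x) / (y * (1 + y))"
        if "0 < y" for s x y :: real
        using that by (simp add: divide_simps) (simp add: algebra_simps)
      show ?thesis unfolding d by (rule *[OF G])
    qed
    also have "\<dots> \<le> ((12 * (K * A) + c2 * (g \<bullet> g)) * (g \<bullet> g)) / ((g \<bullet> g) * (1 + g \<bullet> g))"
      using Hg G by (intro divide_right_mono) auto
    also have "\<dots> = 12 * (K * A) / (1 + g \<bullet> g) + c2 * ((g \<bullet> g) / (1 + g \<bullet> g))"
      using G by (simp add: add_divide_distrib)
    also have "\<dots> \<le> 12 * (K * A) / (g \<bullet> g) + c2 * 1"
    proof -
      have "12 * k / (1 + y) + c2 * (y / (1 + y)) \<le> 12 * k / y + c2 * 1" if "0 < y" "0 \<le> k" for k y :: real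
        using that c2 by (intro add_mono mult_left_mono divide_left_mono) auto
      then show ?thesis using G KA by blast
    qed
    \<comment> \<open>By \<open>c1 g = q\<close> a small \<open>c1\<close> forces a steep
      \<open>u\<close>: \<open>|g| = Q / |c1|\<close>.\<close>
    also have "12 * (K * A) / (g \<bullet> g) = 12 * (K * A) * (c1 / Q)\<^sup>2"
      using gQ[symmetric] g0 by (simp add: power_divide)
    finally show ?thesis using 1 2 by (simp add: N_def c1_def c2_def)
  qed
qed

section \<open>Comparison with the level set flow\<close>

text \<open>\<open>\<rho>\<close> depends only on \<open>K\<close>, \<open>\<kappa>\<close>,
  \<open>C\<close> and \<open>N\<close>, so \<open>\<beta>\<close> and \<open>f\<close> can be
  chosen after it. If \<open>K * A \<le> \<mu>\<close>, the first estimate suffices. Otherwise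
  \<open>Q\<^sup>2 = 16 * (K * A) ^ 3 / K\<close> is bounded below in terms of \<open>\<mu>\<close>,
  whereas \<open>(2 * \<beta> * X)\<^sup>2 \<le> 4 * \<rho> * C\<close>, so the second estimate
  applies and its ratios are small.\<close>

lemma obtain_small_parameter:
  fixes K \<kappa> C N :: real
  assumes "0 < K" "0 < \<kappa>" "0 \<le> C" "0 \<le> N"
  obtains \<rho> where "0 < \<rho>" "\<rho> \<le> 1"
    "\<And>A Q \<beta> X F1 F2 \<tau>. 0 \<le> A \<Longrightarrow> 0 \<le> \<beta> \<Longrightarrow> 0 \<le> X \<Longrightarrow> Q = 4 * K * A * sqrt A \<Longrightarrow> \<beta> \<le> \<rho> \<Longrightarrow> \<beta> * X\<^sup>2 \<le> C \<Longrightarrow>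
       \<bar>F1\<bar> \<le> \<rho> \<Longrightarrow> F2 \<le> \<rho> \<Longrightarrow> \<tau> \<le> 2 * \<beta> * N + (16 + 8 * N) * (K * A) + F2 \<Longrightarrow>
       (2 * \<beta> * X < Q \<Longrightarrow> \<tau> \<le> 2 * \<beta> * N + 48 * (K * A) * (2 * \<beta> * X / Q)\<^sup>2 + F2
          + 12 * (K * A) * (F1 / Q)\<^sup>2) \<Longrightarrow> \<tau> < \<kappa>"
proof -
  define \<mu> where "\<mu> = \<kappa> / (4 * (16 + 8 * N))"
  have \<mu>: "0 < \<mu>" "(16 + 8 * N) * \<mu> = \<kappa> / 4"
  proof -
    have "0 < 16 + 8 * N" using assms by linarith
    moreover have "n * (\<kappa> / (4 * n)) = \<kappa> / 4" if "0 < n" for n :: real using that by simp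
    ultimately show "(16 + 8 * N) * \<mu> = \<kappa> / 4" unfolding \<mu>_def by blast
    show "0 < \<mu>" unfolding \<mu>_def using assms(2) \<open>0 < 16 + 8 * N\<close> by (intro divide_pos_pos) auto
  qed
  \<comment> \<open>Each summand after 1 enforces one of the bounds \<open>s1\<close> to
    \<open>s5\<close>. In both cases the errors then add up to at most
    \<open>\<kappa> / 2\<close>.\<close>
  define M where "M = 1 + 16 * N / \<kappa> + 8 / \<kappa> + C * K / (2 * \<mu> ^ 3) + 96 * C * K / (\<mu>\<^sup>2 * \<kappa>) + 8 * K / (\<mu>\<^sup>2 * \<kappa>)"
  define \<rho> where "\<rho> = 1 / M"
  have terms: "0 \<le> 16 * N / \<kappa>" "0 \<le> 8 / \<kappa>" "0 \<le> C * K / (2 * \<mu> ^ 3)"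
      "0 \<le> 96 * C * K / (\<mu>\<^sup>2 * \<kappa>)" "0 \<le> 8 * K / (\<mu>\<^sup>2 * \<kappa>)"
    using assms \<mu> by auto
  then have M: "M \<ge> 1" by (simp add: M_def)
  then have \<rho>: "0 < \<rho>" "\<rho> \<le> 1" by (auto simp: \<rho>_def)
  have le1: "\<rho> * c \<le> 1" if "c \<le> M" for c
    using that M by (simp add: \<rho>_def divide_le_eq)
  have parts: "16 * N / \<kappa> \<le> M" "8 / \<kappa> \<le> M" "C * K / (2 * \<mu> ^ 3) \<le> M"
      "96 * C * K / (\<mu>\<^sup>2 * \<kappa>) \<le> M" "8 * K / (\<mu>\<^sup>2 * \<kappa>) \<le> M"
    using terms unfolding M_def by linarith+
  have s1: "2 * \<rho> * N \<le> \<kappa> / 8"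
    using le1[OF parts(1)] assms(2) by (simp add: field_simps)
  have s2: "\<rho> \<le> \<kappa> / 8"
    using le1[OF parts(2)] assms(2) by (simp add: field_simps)
  have s3: "4 * \<rho> * C * K \<le> 8 * \<mu> ^ 3"
    using le1[OF parts(3)] \<mu>(1) by (simp add: field_simps)
  have s4: "12 * (\<rho> * C * K / \<mu>\<^sup>2) \<le> \<kappa> / 8"
    using le1[OF parts(4)] \<mu>(1) assms(2) by (simp add: field_simps)
  have s5: "\<rho> * K / \<mu>\<^sup>2 \<le> \<kappa> / 8"
    using le1[OF parts(5)] \<mu>(1) assms(2) by (simp add: field_simps)
  show thesis
  proof (rule that[OF \<rho>])
    fix A Q \<beta> X F1 F2 \<tau> :: real
    assume A: "0 \<le> A" and \<beta>: "0 \<le> \<beta>" "\<beta> \<le> \<rho>" and X: "0 \<le> X" "\<beta> * X\<^sup>2 \<le> C"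
      and Q: "Q = 4 * K * A * sqrt A" and F: "\<bar>F1\<bar> \<le> \<rho>" "F2 \<le> \<rho>"
      and e1: "\<tau> \<le> 2 * \<beta> * N + (16 + 8 * N) * (K * A) + F2"
      and e2: "2 * \<beta> * X < Q \<Longrightarrow> \<tau> \<le> 2 * \<beta> * N + 48 * (K * A) * (2 * \<beta> * X / Q)\<^sup>2 + F2
          + 12 * (K * A) * (F1 / Q)\<^sup>2"
    have \<beta>N: "2 * \<beta> * N \<le> \<kappa> / 8"
      using s1 \<beta>(2) assms(4) mult_right_mono[of \<beta> \<rho> N] by linarith
    show "\<tau> < \<kappa>"
    proof (cases "K * A \<le> \<mu>")
      case True
      then have "(16 + 8 * N) * (K * A) \<le> \<kappa> / 4"
        using \<mu>(2) assms(4) mult_left_mono[of "K * A" \<mu> "16 + 8 * N"] by linarith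
      then show ?thesis using e1 \<beta>N F s2 assms(2) by linarith
    next
      case False
      define k where "k = K * A"
      have k: "\<mu> < k" "0 < k" using False \<mu>(1) by (auto simp: k_def)
      have Q2: "Q\<^sup>2 = 16 * k ^ 3 / K"
        using A assms(1) by (simp add: Q k_def power_mult_distrib power2_eq_square power3_eq_cube)
      have k2: "\<mu>\<^sup>2 \<le> k\<^sup>2" "\<mu> ^ 3 \<le> k ^ 3" using k \<mu>(1) by (auto intro!: power_mono)
      have bX: "(2 * \<beta> * X)\<^sup>2 \<le> 4 * \<rho> * C"
      proof -
        have "(2 * \<beta> * X)\<^sup>2 = 4 * \<beta> * (\<beta> * X\<^sup>2)" by (simp add: power2_eq_square)
        also have "\<dots> \<le> 4 * \<rho> * C" using \<beta> X assms(3) by (intro mult_mono) auto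
        finally show ?thesis .
      qed
      also have "\<dots> \<le> 8 * \<mu> ^ 3 / K" using s3 assms(1) by (simp add: field_simps)
      also have "\<dots> < Q\<^sup>2"
      proof -
        have "8 * \<mu> ^ 3 < 16 * k ^ 3" using k2(2) zero_less_power[OF k(2), of 3] by linarith
        then show ?thesis unfolding Q2 using assms(1) by (rule divide_strict_right_mono)
      qed
      finally have "2 * \<beta> * X < Q"
        by (rule power2_less_imp_less) (use A assms(1) in \<open>auto simp: Q\<close>)
      from e2[OF this]
      have \<tau>: "\<tau> \<le> 2 * \<beta> * N + 48 * k * ((2 * \<beta> * X)\<^sup>2 / Q\<^sup>2) + F2 + 12 * k * (F1\<^sup>2 / Q\<^sup>2)"
        unfolding k_def power_divide .
      have "48 * k * ((2 * \<beta> * X)\<^sup>2 / Q\<^sup>2) \<le> 48 * k * (4 * \<rho> * C / Q\<^sup>2)"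
        using bX k(2) by (intro mult_left_mono divide_right_mono) auto
      also have "\<dots> = 12 * (\<rho> * C * K / k\<^sup>2)"
        unfolding Q2 using k(2) assms(1) by (simp add: field_simps power2_eq_square power3_eq_cube)
      also have "\<dots> \<le> 12 * (\<rho> * C * K / \<mu>\<^sup>2)"
        using k2 \<mu>(1) k(2) \<rho> assms by (intro mult_left_mono divide_left_mono) auto
      finally have t1: "48 * k * ((2 * \<beta> * X)\<^sup>2 / Q\<^sup>2) \<le> \<kappa> / 8" using s4 by linarith
      have "F1\<^sup>2 \<le> \<rho>\<^sup>2" using power_mono[OF F(1) abs_ge_zero, of 2] by simp
      also have "\<dots> \<le> \<rho>" using \<rho> by (simp add: power2_eq_square mult_left_le)
      finally have "12 * k * (F1\<^sup>2 / Q\<^sup>2) \<le> 12 * k * (\<rho> / Q\<^sup>2)"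
        using k(2) by (intro mult_left_mono divide_right_mono) auto
      also have "\<dots> = 3 / 4 * (\<rho> * K / k\<^sup>2)"
        unfolding Q2 using k(2) assms(1) by (simp add: field_simps power2_eq_square power3_eq_cube)
      also have "\<dots> \<le> 1 * (\<rho> * K / k\<^sup>2)"
        using k(2) \<rho> assms(1) by (intro mult_right_mono) auto
      also have "\<dots> \<le> 1 * (\<rho> * K / \<mu>\<^sup>2)"
        using k2 \<mu>(1) k(2) \<rho> assms by (intro mult_left_mono divide_left_mono) auto
      finally have t2: "12 * k * (F1\<^sup>2 / Q\<^sup>2) \<le> \<kappa> / 8" using s5 by linarith
      show ?thesis using \<tau> t1 t2 \<beta>N F s2 assms(2) by linarith
    qed
  qed
qed

lemma gmcf_classical_subset: "gmcf_classical S u \<Longrightarrow> T \<subseteq> S \<Longrightarrow> gmcf_classical T u"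
  unfolding gmcf_classical_def C21_on_def by (auto elim: continuous_on_subset)

lemma power4_inner_eq_norm: "((x::'a::real_inner) \<bullet> x)\<^sup>2 = norm x ^ 4"
  by (simp add: dot_square_norm power_mult[symmetric])

lemma has_real_derivative_pole:
  assumes "t \<noteq> T"
  shows "((\<lambda>t. \<eta> / (T - t)) has_real_derivative \<eta> / (T - t)\<^sup>2) (at (t::real))"
  using assms by (auto intro!: derivative_eq_intros simp: power2_eq_square)

text \<open>The bound \<open>z\<close> is fixed before \<open>U\<close> and \<open>L\<close>. This
  is possible because the initial values enter only through an upper bound of \<open>u0\<close> on a
  compact subset of \<open>A\<close>, and \<open>cut_init\<close> does not exceed \<open>u0\<close>
  on \<open>A\<close>.\<close>

lemma height_bound_on_negative_set:
  fixes v :: "'a::euclidean_space \<times> real \<Rightarrow> real"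
  assumes V: "supersol_test v" and cont: "continuous_on (UNIV \<times> {0..}) v"
    and bd: "\<And>x t. 0 \<le> t \<Longrightarrow> \<bar>v (x, t)\<bar> \<le> C"
    and u0: "continuous_on A u0"
    and init: "\<And>x c. v (x, 0) \<le> - c \<Longrightarrow> 0 < c \<Longrightarrow> ball x c \<subseteq> A"
    and neg: "v (x1, t1) < 0" "0 \<le> t1"
  obtains z where "\<And>U L. continuous_on (UNIV \<times> {0..}) U \<Longrightarrow> gmcf_classical (UNIV \<times> {0<..}) U \<Longrightarrow>
     (\<And>x. U (x, 0) = cut_init A u0 L x) \<Longrightarrow> U (x1, t1) \<le> z"
proof -
  \<comment> \<open>Of the depth \<open>4 * \<eta>\<close> at the given point,
    \<open>\<theta>\<close>, the \<open>\<beta>\<close> term and \<open>f\<close> use up at most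
    \<open>\<eta>\<close> each, so \<open>G\<close> is at most \<open>- \<eta>\<close>
    there.\<close>
  define \<eta> where "\<eta> = - v (x1, t1) / 4"
  have \<eta>: "0 < \<eta>" "v (x1, t1) = - 4 * \<eta>" "4 * \<eta> \<le> C"
    using neg bd[of t1 x1] by (auto simp: \<eta>_def)
  have C: "0 < C" using \<eta> by linarith
  define T where "T = t1 + 1"
  \<comment> \<open>At time \<open>T - s0\<close> the pole term \<open>\<theta>\<close> has reached
    \<open>2 * C\<close>, too much for a minimum of \<open>G\<close>; the last time is thereby
    excluded.\<close>
  define s0 where "s0 = \<eta> / (2 * C)"
  have s0: "0 < s0" "s0 < 1" "\<eta> / s0 = 2 * C" using \<eta> C by (auto simp: s0_def field_simps)
  have T: "0 < T" "t1 < T - s0" using neg s0 by (auto simp: T_def)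
  define \<theta> where "\<theta> t = \<eta> / (T - t)" for t
  \<comment> \<open>A lower bound for the derivative of \<open>\<theta>\<close> on
    \<open>[0, T)\<close>.\<close>
  define \<kappa> where "\<kappa> = \<eta> / T\<^sup>2"
  have \<kappa>: "0 < \<kappa>" using \<eta> T by (simp add: \<kappa>_def)
  \<comment> \<open>Chosen so that distance \<open>\<eta> / 2\<close> between \<open>x\<close> and
    \<open>y\<close> already costs \<open>2 * C\<close>.\<close>
  define K where "K = 32 * C / \<eta> ^ 4"
  have K: "0 < K" using C \<eta> by (simp add: K_def)
  have KC: "norm w \<le> \<eta> / 2" if "K * norm w ^ 4 \<le> C" for w :: 'a
  proof (rule ccontr)
    assume "\<not> norm w \<le> \<eta> / 2"
    then have "(\<eta> / 2) ^ 4 \<le> norm w ^ 4" using \<eta> by (intro power_mono) auto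
    then have "K * (\<eta> / 2) ^ 4 \<le> C" using that K mult_left_mono[of "(\<eta> / 2) ^ 4" "norm w ^ 4" K] by linarith
    moreover have "K * (\<eta> / 2) ^ 4 = 2 * C" using \<eta> by (simp add: K_def power_divide)
    ultimately show False using C by linarith
  qed
  obtain \<rho> where \<rho>: "0 < \<rho>" "\<rho> \<le> 1" and small:
    "\<And>A Q \<beta> X F1 F2 \<tau>. 0 \<le> A \<Longrightarrow> 0 \<le> \<beta> \<Longrightarrow> 0 \<le> X \<Longrightarrow> Q = 4 * K * A * sqrt A \<Longrightarrow> \<beta> \<le> \<rho> \<Longrightarrow> \<beta> * X\<^sup>2 \<le> C \<Longrightarrow>
       \<bar>F1\<bar> \<le> \<rho> \<Longrightarrow> F2 \<le> \<rho> \<Longrightarrow> \<tau> \<le> 2 * \<beta> * real DIM('a) + (16 + 8 * real DIM('a)) * (K * A) + F2 \<Longrightarrow>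
       (2 * \<beta> * X < Q \<Longrightarrow> \<tau> \<le> 2 * \<beta> * real DIM('a) + 48 * (K * A) * (2 * \<beta> * X / Q)\<^sup>2 + F2
          + 12 * (K * A) * (F1 / Q)\<^sup>2) \<Longrightarrow> \<tau> < \<kappa>"
    using obtain_small_parameter[OF K \<kappa>, of C "real DIM('a)"] C by (metis less_imp_le of_nat_0_le_iff)
  define \<beta> where "\<beta> = min \<rho> (\<eta> / (1 + x1 \<bullet> x1))"
  have x1p: "0 < 1 + x1 \<bullet> x1" by (simp add: add_pos_nonneg)
  have \<beta>: "0 < \<beta>" "\<beta> \<le> \<rho>" using \<rho> \<eta> x1p by (auto simp: \<beta>_def)
  have \<beta>x1: "\<beta> * (x1 \<bullet> x1) \<le> \<eta>"
  proof -
    have "\<beta> * (x1 \<bullet> x1) \<le> \<beta> * (1 + x1 \<bullet> x1)" using \<beta> by (intro mult_left_mono) auto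
    also have "\<dots> \<le> \<eta> / (1 + x1 \<bullet> x1) * (1 + x1 \<bullet> x1)"
      using x1p by (intro mult_right_mono) (auto simp: \<beta>_def)
    also have "\<dots> = \<eta>" using x1p by simp
    finally show ?thesis .
  qed
  define \<epsilon> where "\<epsilon> = \<rho> / (1 + C)"
  have \<epsilon>: "0 < \<epsilon>" "\<epsilon> \<le> 1" "\<epsilon> * C \<le> \<rho>"
    using \<rho> C by (auto simp: \<epsilon>_def field_simps)
  define R where "R = sqrt (C / \<beta>)"
  have R: "norm x \<le> R" if "\<beta> * (x \<bullet> x) \<le> C" for x :: 'a
    unfolding R_def norm_eq_sqrt_inner using that \<beta> by (simp add: pos_le_divide_eq mult.commute)
  \<comment> \<open>Holds every \<open>y0\<close> that can occur at time 0: there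
    \<open>v (x0, 0) \<le> - \<eta>\<close> gives \<open>ball x0 \<eta> \<subseteq> A\<close>, and
    \<open>|x0 - y0| \<le> \<eta> / 2\<close> leaves a margin \<open>\<eta> / 2\<close> around
    \<open>y0\<close>. The margin makes \<open>P\<close> a compact subset of
    \<open>A\<close>.\<close>
  define P where "P = cball 0 (R + \<eta>) \<inter> - (\<Union>w\<in>- A. ball w (\<eta> / 2))"
  have "compact P" unfolding P_def
    by (intro compact_Int_closed compact_cball) (auto simp: closed_def)
  moreover have P_iff: "y \<in> P \<longleftrightarrow> norm y \<le> R + \<eta> \<and> ball y (\<eta> / 2) \<subseteq> A" for y
    by (force simp: P_def dist_commute)
  moreover have "P \<subseteq> A" using P_iff \<eta> by force
  ultimately have "bounded (u0 ` P)"
    using u0 by (meson compact_continuous_image compact_imp_bounded continuous_on_subset)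
  then obtain M where M: "\<And>y. y \<in> P \<Longrightarrow> u0 y \<le> M"
    unfolding bounded_iff by (metis abs_le_D1 imageI real_norm_def)
  \<comment> \<open>The gap between \<open>M\<close> and \<open>z\<close> makes \<open>f\<close>
    exceed \<open>C\<close> below \<open>M\<close>, which excludes time 0, although \<open>f\<close>
    is at most \<open>\<eta>\<close> above \<open>z\<close>. An exponential is used because its
    derivatives are multiples of \<open>f\<close>, hence small wherever \<open>f \<le> C\<close>,
    whatever the size of \<open>U\<close>.\<close>
  define z where "z = M + C / (\<eta> * \<epsilon>)"
  define f where "f s = \<eta> * exp (\<epsilon> * (z - s))" for s
  have f_pos: "0 < f s" for s using \<eta> by (simp add: f_def)
  have fM: "C < f s" if "s \<le> M" for s
  proof -
    have "C / \<eta> < 1 + C / \<eta>" by simp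
    also have "\<dots> \<le> exp (C / \<eta>)" by (rule exp_ge_add_one_self)
    also have "C / \<eta> = \<epsilon> * (C / (\<eta> * \<epsilon>))" using \<epsilon> by simp
    also have "exp \<dots> \<le> exp (\<epsilon> * (z - s))" unfolding z_def using that \<epsilon> by (intro iffD2[OF exp_le_cancel_iff] mult_left_mono) auto
    finally show ?thesis using \<eta> \<epsilon> by (simp add: f_def field_simps)
  qed
  have df: "(f has_real_derivative (- \<epsilon>) * f s) (at s)"
    "((\<lambda>s. (- \<epsilon>) * f s) has_real_derivative \<epsilon>\<^sup>2 * f s) (at s)" for s
    unfolding f_def by (auto intro!: derivative_eq_intros simp: power2_eq_square)
  have cf: "continuous_on S f" for S unfolding f_def by (intro continuous_intros)
  have "U (x1, t1) \<le> z"
    if U: "continuous_on (UNIV \<times> {0..}) U" "gmcf_classical (UNIV \<times> {0<..}) U"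
      and U0: "\<And>x. U (x, 0) = cut_init A u0 L x" for U L
  proof (rule ccontr)
    assume high: "\<not> U (x1, t1) \<le> z"
    define G where "G x y t = v (x, t) + \<theta> t + \<beta> * (x \<bullet> x) + K * ((x - y) \<bullet> (x - y))\<^sup>2 + f (U (y, t))" for x y t
    have G1: "G x1 x1 t1 \<le> - \<eta>"
    proof -
      have "f (U (x1, t1)) \<le> \<eta>" using high \<eta> \<epsilon> by (simp add: f_def mult_le_0_iff)
      moreover have "\<theta> t1 = \<eta>" by (simp add: \<theta>_def T_def)
      ultimately show ?thesis using \<eta>(2) \<beta>x1 by (simp add: G_def)
    qed
    have Glow: "\<theta> t + \<beta> * (x \<bullet> x) + K * norm (x - y) ^ 4 + f (U (y, t)) < C \<and> \<theta> t \<ge> 0"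
      if "G x y t \<le> - \<eta>" "0 \<le> t" "t \<le> T - s0" for x y t
      using that bd[of t x] \<eta>(1) s0(1) by (auto simp: G_def power4_inner_eq_norm \<theta>_def)
    have Gdom: "norm x \<le> R \<and> norm (x - y) \<le> \<eta> / 2 \<and> norm y \<le> R + \<eta>"
      if "G x y t \<le> - \<eta>" "0 \<le> t" "t \<le> T - s0" for x y t
    proof -
      have nn: "0 \<le> \<beta> * (x \<bullet> x)" "0 \<le> K * norm (x - y) ^ 4" using \<beta> K by auto
      have "\<beta> * (x \<bullet> x) \<le> C" "K * norm (x - y) ^ 4 \<le> C"
        using Glow[OF that] nn f_pos[of "U (y, t)"] by linarith+
      then have "norm x \<le> R" "norm (x - y) \<le> \<eta> / 2" by (simp_all only: R KC)
      moreover have "norm y \<le> norm x + norm (x - y)" by (metis norm_minus_commute norm_triangle_sub)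
      ultimately show ?thesis using \<eta>(1) by linarith
    qed
    define D where "D = cball (0::'a) R \<times> cball (0::'a) (R + \<eta>) \<times> {0..T - s0}"
    have "compact D" unfolding D_def by (intro compact_Times compact_cball compact_Icc)
    moreover have "continuous_on D (\<lambda>(x, y, t). G x y t)"
    proof -
      have "continuous_on D (\<lambda>p. v (fst p, snd (snd p)))" "continuous_on D (\<lambda>p. U (fst (snd p), snd (snd p)))"
        by (rule continuous_on_compose2[OF cont] continuous_on_compose2[OF U(1)];
            force simp: D_def intro!: continuous_intros)+
      moreover have "T - snd (snd p) \<noteq> 0" if "p \<in> D" for p using that s0 by (auto simp: D_def)
      moreover have "continuous_on D (\<lambda>p. f (U (fst (snd p), snd (snd p))))"
        by (rule continuous_on_compose2[OF cf[of UNIV]]) (use calculation in auto)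
      ultimately show ?thesis
        unfolding G_def \<theta>_def case_prod_unfold by (intro continuous_intros) auto
    qed
    moreover have in1: "(x1, x1, t1) \<in> D"
      using Gdom[OF G1] neg T \<eta> by (auto simp: D_def)
    ultimately obtain q where q: "q \<in> D" "\<And>r. r \<in> D \<Longrightarrow> (case q of (x, y, t) \<Rightarrow> G x y t) \<le> (case r of (x, y, t) \<Rightarrow> G x y t)"
      using continuous_attains_inf[of D "\<lambda>(x, y, t). G x y t"] by blast
    obtain x0 y0 t0 where q_eq: "q = (x0, y0, t0)" by (cases q)
    have G0: "G x0 y0 t0 \<le> - \<eta>" using q(2)[OF in1] G1 by (simp add: q_eq)
    have t0: "0 \<le> t0" "t0 \<le> T - s0" using q(1) by (auto simp: q_eq D_def)
    \<comment> \<open>Outside \<open>D\<close> the value of \<open>G\<close> exceeds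
      \<open>- \<eta>\<close>, so the minimum over \<open>D\<close> is one over all
      \<open>x\<close>, \<open>y\<close> and all times up to \<open>T - s0\<close>.\<close>
    have min: "G x0 y0 t0 \<le> G x y t" if "0 \<le> t" "t \<le> T - s0" for x y t
    proof (cases "G x y t \<le> - \<eta>")
      case True
      then have "(x, y, t) \<in> D" using Gdom[OF True that] that by (auto simp: D_def)
      then show ?thesis using q(2)[of "(x, y, t)"] by (simp add: q_eq)
    qed (use G0 in linarith)
    note low = Glow[OF G0 t0]
    have nn: "0 \<le> \<beta> * (x0 \<bullet> x0)" "0 \<le> K * norm (x0 - y0) ^ 4" using \<beta> K by auto
    have "t0 \<noteq> T - s0"
    proof
      assume "t0 = T - s0"
      then have "\<theta> t0 = 2 * C" using s0(3) by (simp add: \<theta>_def)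
      then show False using low nn f_pos[of "U (y0, t0)"] C by linarith
    qed
    moreover have "t0 \<noteq> 0"
    proof
      assume 0: "t0 = 0"
      have "v (x0, 0) \<le> - \<eta>" using G0 nn f_pos[of "U (y0, t0)"] low by (simp add: G_def 0 power4_inner_eq_norm)
      then have "ball x0 \<eta> \<subseteq> A" using init \<eta> by blast
      moreover have "ball y0 (\<eta> / 2) \<subseteq> ball x0 \<eta>"
        using Gdom[OF G0 t0] by (simp add: ball_subset_ball_iff dist_norm norm_minus_commute)
      ultimately have "y0 \<in> P" using Gdom[OF G0 t0] by (auto simp: P_iff)
      moreover have "y0 \<in> A" using \<open>y0 \<in> P\<close> P_iff[of y0] \<eta> by force
      ultimately have "U (y0, 0) \<le> M" using M[of y0] by (simp add: U0 cut_init_def)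
      then have "C < f (U (y0, t0))" using fM by (simp add: 0)
      then show False using low nn by linarith
    qed
    ultimately have t0': "0 < t0" "t0 < T - s0" using t0 by auto
    define W where "W = (UNIV :: 'a set) \<times> {0<..<T - s0}"
    have W: "open W" "W \<subseteq> UNIV \<times> {0<..}" "(y0, t0) \<in> W" "snd ` W = {0<..<T - s0}"
      using t0' by (auto simp: W_def open_Times)
    have \<theta>': "\<forall>t\<in>snd ` W. (\<theta> has_real_derivative \<eta> / (T - t)\<^sup>2) (at t)"
      unfolding \<theta>_def using s0 W(4) by (intro ballI has_real_derivative_pole) auto
    have c\<theta>': "continuous_on (snd ` W) (\<lambda>t. \<eta> / (T - t)\<^sup>2)"
      unfolding W(4) using s0 by (intro continuous_intros) auto
    have cf'': "continuous_on UNIV (\<lambda>s. \<epsilon>\<^sup>2 * f s)" by (intro continuous_intros cf)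
    have f''0: "0 \<le> \<epsilon>\<^sup>2 * f s" for s using f_pos[of s] by simp
    have minW: "\<forall>x y t. (y, t) \<in> W \<longrightarrow> v (x0, t0) + \<theta> t0 + \<beta> * (x0 \<bullet> x0) + K * ((x0 - y0) \<bullet> (x0 - y0))\<^sup>2 + f (U (y0, t0))
       \<le> v (x, t) + \<theta> t + \<beta> * (x \<bullet> x) + K * ((x - y) \<bullet> (x - y))\<^sup>2 + f (U (y, t))"
      using min by (simp add: G_def W_def)
    note est = interior_minimum_estimates[OF V W(1,2) gmcf_classical_subset[OF U(2) W(2)] W(3) df cf'' f''0
        \<theta>' c\<theta>' less_imp_le[OF \<beta>(1)] less_imp_le[OF K] minW]
    have fC: "f (U (y0, t0)) \<le> C" using low nn by linarith
    have "\<eta> / (T - t0)\<^sup>2 < \<kappa>"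
    proof (rule small[OF _ _ _ _ \<beta>(2) _ _ _ est])
      show "\<beta> * (norm x0)\<^sup>2 \<le> C" using low nn f_pos[of "U (y0, t0)"] by (simp add: power2_norm_eq_inner)
      show "4 * K * ((x0 - y0) \<bullet> (x0 - y0)) * norm (x0 - y0) = 4 * K * ((x0 - y0) \<bullet> (x0 - y0)) * sqrt ((x0 - y0) \<bullet> (x0 - y0))"
        by (simp add: norm_eq_sqrt_inner)
      have "\<epsilon> * f (U (y0, t0)) \<le> \<epsilon> * C" using fC \<epsilon> by (intro mult_left_mono) auto
      then have 1: "\<epsilon> * f (U (y0, t0)) \<le> \<rho>" using \<epsilon> by linarith
      then show "\<bar>- \<epsilon> * f (U (y0, t0))\<bar> \<le> \<rho>" using \<epsilon> f_pos[of "U (y0, t0)"] by (simp add: abs_mult)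
      have "\<epsilon> * (\<epsilon> * f (U (y0, t0))) \<le> 1 * (\<epsilon> * f (U (y0, t0)))"
        using \<epsilon> f_pos[of "U (y0, t0)"] by (intro mult_right_mono) auto
      then show "\<epsilon>\<^sup>2 * f (U (y0, t0)) \<le> \<rho>" using 1 by (simp add: power2_eq_square mult.assoc)
    qed (use \<beta> in auto)
    moreover have "\<kappa> \<le> \<eta> / (T - t0)\<^sup>2"
      unfolding \<kappa>_def using \<eta> t0' s0 T by (intro divide_left_mono power_mono) auto
    ultimately show False by linarith
  qed
  then show thesis using that by blast
qed

text \<open>Here \<open>\<beta> = 0\<close>: properness of \<open>u\<close> confines
  \<open>(y, t)\<close> to a compact subset of \<open>\<Omega>\<close>, which also keeps the minimum
  off the lateral boundary of \<open>\<Omega>\<close>, and the penalty confines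
  \<open>x - y\<close>. An affine \<open>f\<close> suffices since \<open>u\<close> is bounded
  below.\<close>

lemma nonpositive_on_solution_domain:
  fixes v u :: "'a::euclidean_space \<times> real \<Rightarrow> real"
  assumes V: "supersol_test (\<lambda>p. - v p)" and cont: "continuous_on (UNIV \<times> {0..}) v"
    and bd: "\<And>x t. 0 \<le> t \<Longrightarrow> \<bar>v (x, t)\<bar> \<le> C"
    and sol: "sing_resolving_solution A u0 \<Omega> u"
    and init: "\<And>x y. y \<in> A \<Longrightarrow> v (x, 0) \<le> norm (x - y)"
    and in\<Omega>: "(y1, t1) \<in> \<Omega>"
  shows "v (y1, t1) \<le> 0"
proof (rule ccontr)
  assume pos: "\<not> v (y1, t1) \<le> 0"
  obtain O' where O': "open O'" "\<Omega> = (UNIV \<times> {0..}) \<inter> O'"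
    using sol unfolding sing_resolving_solution_def openin_open by blast
  have u: "continuous_on \<Omega> u" "gmcf_classical (\<Omega> - A \<times> {0}) u"
    and slice0: "\<And>y. (y, 0) \<in> \<Omega> \<longleftrightarrow> y \<in> A"
    and proper: "\<And>T K. T > 0 \<Longrightarrow> compact K \<Longrightarrow> compact {p\<in>\<Omega>. snd p \<le> T \<and> u p \<in> K}"
    using sol unfolding sing_resolving_solution_def tslice_def by auto
  obtain c where c: "\<And>p. p \<in> \<Omega> \<Longrightarrow> - c \<le> u p"
    using sol unfolding sing_resolving_solution_def bdd_below_def by (metis imageI minus_minus)
  have t1: "0 \<le> t1" using in\<Omega> O'(2) by auto
  define \<eta> where "\<eta> = v (y1, t1) / 4"
  have \<eta>: "0 < \<eta>" "v (y1, t1) = 4 * \<eta>" "4 * \<eta> \<le> C"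
    using pos bd[OF t1, of y1] by (auto simp: \<eta>_def)
  have C: "0 < C" using \<eta> by linarith
  define T where "T = t1 + 1"
  define s0 where "s0 = \<eta> / (2 * C)"
  have s0: "0 < s0" "s0 < 1" "\<eta> / s0 = 2 * C" using \<eta> C by (auto simp: s0_def field_simps)
  have T: "0 < T" "t1 < T - s0" using t1 s0 by (auto simp: T_def)
  define \<theta> where "\<theta> t = \<eta> / (T - t)" for t
  define \<kappa> where "\<kappa> = \<eta> / T\<^sup>2"
  have \<kappa>: "0 < \<kappa>" using \<eta> T by (simp add: \<kappa>_def)
  \<comment> \<open>Excludes time 0: with \<open>n = |x0 - y0|\<close> one gets
    \<open>2 * \<eta> + K * n ^ 4 \<le> n\<close>, hence \<open>n \<ge> 2 * \<eta>\<close>, and then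
    \<open>K * n ^ 4 \<ge> K * (2 * \<eta>) ^ 3 * n = 8 * n\<close>.\<close>
  define K where "K = 1 / \<eta> ^ 3"
  have K: "0 < K" using \<eta> by (simp add: K_def)
  obtain \<rho> where \<rho>: "0 < \<rho>" "\<rho> \<le> 1" and small:
    "\<And>A Q \<beta> X F1 F2 \<tau>. 0 \<le> A \<Longrightarrow> 0 \<le> \<beta> \<Longrightarrow> 0 \<le> X \<Longrightarrow> Q = 4 * K * A * sqrt A \<Longrightarrow> \<beta> \<le> \<rho> \<Longrightarrow> \<beta> * X\<^sup>2 \<le> C \<Longrightarrow>
       \<bar>F1\<bar> \<le> \<rho> \<Longrightarrow> F2 \<le> \<rho> \<Longrightarrow> \<tau> \<le> 2 * \<beta> * real DIM('a) + (16 + 8 * real DIM('a)) * (K * A) + F2 \<Longrightarrow>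
       (2 * \<beta> * X < Q \<Longrightarrow> \<tau> \<le> 2 * \<beta> * real DIM('a) + 48 * (K * A) * (2 * \<beta> * X / Q)\<^sup>2 + F2
          + 12 * (K * A) * (F1 / Q)\<^sup>2) \<Longrightarrow> \<tau> < \<kappa>"
    using obtain_small_parameter[OF K \<kappa>, of C "real DIM('a)"] C by (metis less_imp_le of_nat_0_le_iff)
  define h where "h = u (y1, t1) + c"
  have h: "0 \<le> h" using c[OF in\<Omega>] by (simp add: h_def)
  \<comment> \<open>The second argument of \<open>min\<close> limits \<open>f\<close> to
    \<open>\<eta>\<close> at the given point, where the height above \<open>- c\<close> is
    \<open>h\<close>.\<close>
  define \<epsilon> where "\<epsilon> = min \<rho> (\<eta> / (1 + h))"
  have \<epsilon>: "0 < \<epsilon>" "\<epsilon> \<le> \<rho>" using \<rho> \<eta> h by (auto simp: \<epsilon>_def)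
  have \<epsilon>h: "\<epsilon> * h \<le> \<eta>"
  proof -
    have "\<epsilon> * h \<le> \<eta> / (1 + h) * (1 + h)" using \<epsilon> h by (intro mult_mono) (auto simp: \<epsilon>_def)
    also have "\<dots> = \<eta>" using h by simp
    finally show ?thesis .
  qed
  define f where "f s = \<epsilon> * (s + c)" for s
  have f_nonneg: "0 \<le> f (u p)" if "p \<in> \<Omega>" for p using c[OF that] \<epsilon> by (simp add: f_def)
  have df: "(f has_real_derivative \<epsilon>) (at s)" "((\<lambda>s. \<epsilon>) has_real_derivative 0) (at s)" for s
    unfolding f_def by (auto intro!: derivative_eq_intros)
  define G where "G x y t = - v (x, t) + \<theta> t + 0 * (x \<bullet> x) + K * ((x - y) \<bullet> (x - y))\<^sup>2 + f (u (y, t))" for x y t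
  have G1: "G y1 y1 t1 \<le> - 2 * \<eta>"
  proof -
    have "f (u (y1, t1)) \<le> \<eta>" using \<epsilon>h by (simp add: f_def h_def)
    moreover have "\<theta> t1 = \<eta>" by (simp add: \<theta>_def T_def)
    ultimately show ?thesis using \<eta>(2) by (simp add: G_def)
  qed
  define P where "P = {p\<in>\<Omega>. snd p \<le> T - s0 \<and> u p \<in> {- c..C / \<epsilon> - c}}"
  \<comment> \<open>The 1 ensures \<open>n ^ 4 \<ge> n\<close> for \<open>n > r\<close>, so that the
    penalty exceeds \<open>C\<close> there.\<close>
  define r where "r = 1 + C / K"
  have t_nonneg: "0 \<le> t" if "(y, t) \<in> \<Omega>" for y t using that O'(2) by auto
  have Glow: "\<theta> t + K * norm (x - y) ^ 4 + f (u (y, t)) < C \<and> 0 \<le> \<theta> t"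
    if "G x y t \<le> - 2 * \<eta>" "(y, t) \<in> \<Omega>" "t \<le> T - s0" for x y t
    using that t_nonneg[OF that(2)] bd[of t x] \<eta>(1) s0(1)
    by (auto simp: G_def power4_inner_eq_norm \<theta>_def)
  have Gdom: "norm (x - y) \<le> r \<and> (y, t) \<in> P"
    if "G x y t \<le> - 2 * \<eta>" "(y, t) \<in> \<Omega>" "t \<le> T - s0" for x y t
  proof
    note low = Glow[OF that] and fn = f_nonneg[OF that(2)]
    show "norm (x - y) \<le> r"
    proof (rule ccontr)
      assume "\<not> norm (x - y) \<le> r"
      then have n: "1 \<le> norm (x - y)" "C / K \<le> norm (x - y)"
        using C K by (auto simp: r_def intro: order_trans[of _ "1 + C / K"])
      have "C / K \<le> norm (x - y) ^ 4" using n power_increasing[of 1 4 "norm (x - y)"] by simp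
      then have "C \<le> K * norm (x - y) ^ 4" using K by (simp add: divide_le_eq mult.commute)
      then show False using low fn by linarith
    qed
    have "0 \<le> K * norm (x - y) ^ 4" using K by simp
    then have "\<epsilon> * (u (y, t) + c) \<le> C" using low unfolding f_def by linarith
    then have "u (y, t) + c \<le> C / \<epsilon>" using \<epsilon> by (simp add: pos_le_divide_eq mult.commute)
    then show "(y, t) \<in> P" using that c[OF that(2)] by (simp add: P_def)
  qed
  have "compact P" unfolding P_def using T t1 by (intro proper compact_Icc) linarith
  then have "compact (cball (0::'a) r \<times> P)" by (intro compact_Times compact_cball)
  \<comment> \<open>Writing \<open>x = y + w\<close> turns the bounds on \<open>x - y\<close> and on
    \<open>(y, t)\<close> into a compact product.\<close>
  moreover have "continuous_on (cball (0::'a) r \<times> P) (\<lambda>(w, y, t). G (y + w) y t)"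
  proof -
    have "continuous_on (cball (0::'a) r \<times> P) (\<lambda>p. v (fst (snd p) + fst p, snd (snd p)))"
      by (rule continuous_on_compose2[OF cont]) (force simp: P_def intro!: continuous_intros t_nonneg)+
    moreover have "continuous_on (cball (0::'a) r \<times> P) (\<lambda>p. u (fst (snd p), snd (snd p)))"
      by (rule continuous_on_compose2[OF u(1)]) (auto simp: P_def intro!: continuous_intros)
    moreover have "T - snd (snd p) \<noteq> 0" if "p \<in> cball (0::'a) r \<times> P" for p
      using that s0 by (auto simp: P_def)
    ultimately show ?thesis
      unfolding G_def \<theta>_def f_def case_prod_unfold by (intro continuous_intros) auto
  qed
  moreover have in1: "(0, y1, t1) \<in> cball (0::'a) r \<times> P"
    using Gdom[OF G1 in\<Omega>] T by auto
  ultimately obtain q where q: "q \<in> cball (0::'a) r \<times> P"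
    "\<And>s. s \<in> cball (0::'a) r \<times> P \<Longrightarrow> (case q of (w, y, t) \<Rightarrow> G (y + w) y t) \<le> (case s of (w, y, t) \<Rightarrow> G (y + w) y t)"
    using continuous_attains_inf[of "cball (0::'a) r \<times> P" "\<lambda>(w, y, t). G (y + w) y t"] by blast
  obtain w0 y0 t0 where q_eq: "q = (w0, y0, t0)" by (cases q)
  define x0 where "x0 = y0 + w0"
  have G0: "G x0 y0 t0 \<le> - 2 * \<eta>" using q(2)[OF in1] G1 by (simp add: q_eq x0_def)
  have in0: "(y0, t0) \<in> \<Omega>" "t0 \<le> T - s0" using q(1) by (auto simp: q_eq P_def)
  have min: "G x0 y0 t0 \<le> G x y t" if "(y, t) \<in> \<Omega>" "t \<le> T - s0" for x y t
  proof (cases "G x y t \<le> - 2 * \<eta>")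
    case True
    then show ?thesis using Gdom[OF True that] q(2)[of "(x - y, y, t)"] by (simp add: q_eq x0_def)
  qed (use G0 in linarith)
  note low = Glow[OF G0 in0]
  have nn: "0 \<le> K * norm (x0 - y0) ^ 4" using K by auto
  have "t0 \<noteq> T - s0"
  proof
    assume "t0 = T - s0"
    then have "\<theta> t0 = 2 * C" using s0(3) by (simp add: \<theta>_def)
    then show False using low nn f_nonneg[OF in0(1)] C by linarith
  qed
  moreover have "t0 \<noteq> 0"
  proof
    assume 0: "t0 = 0"
    let ?n = "norm (x0 - y0)"
    have "v (x0, 0) \<le> ?n" using init in0(1) slice0 by (simp add: 0)
    then have n: "2 * \<eta> + K * ?n ^ 4 \<le> ?n"
      using G0 f_nonneg[OF in0(1)] low by (simp add: G_def 0 power4_inner_eq_norm)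
    then have ge: "2 * \<eta> \<le> ?n" using nn by linarith
    then have "(2 * \<eta>) ^ 3 \<le> ?n ^ 3" using \<eta> by (intro power_mono) auto
    then have "K * (2 * \<eta>) ^ 3 * ?n \<le> K * ?n ^ 3 * ?n" using K by (intro mult_right_mono mult_left_mono) auto
    moreover have "K * (2 * \<eta>) ^ 3 = 8" using \<eta> by (simp add: K_def power_mult_distrib)
    moreover have "K * ?n ^ 3 * ?n = K * ?n ^ 4" by (simp add: eval_nat_numeral)
    ultimately have "8 * ?n \<le> K * ?n ^ 4" by metis
    then show False using n ge \<eta> by linarith
  qed
  ultimately have t0: "0 < t0" "t0 < T - s0" using in0 t_nonneg by force+
  \<comment> \<open>\<open>\<Omega>\<close> is only relatively open at time 0; cutting to positive
    times gives an open set on which the equation holds.\<close>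
  define W where "W = O' \<inter> UNIV \<times> {0<..<T - s0}"
  have W\<Omega>: "W \<subseteq> \<Omega> - A \<times> {0}" "snd ` W \<subseteq> {0<..<T - s0}" by (auto simp: W_def O'(2))
  have W: "open W" "W \<subseteq> UNIV \<times> {0<..}" "(y0, t0) \<in> W"
    using t0 O' in0 by (auto simp: W_def open_Times)
  have \<theta>': "\<forall>t\<in>snd ` W. (\<theta> has_real_derivative \<eta> / (T - t)\<^sup>2) (at t)"
    unfolding \<theta>_def using s0 W\<Omega>(2) by (intro ballI has_real_derivative_pole) auto
  have c\<theta>': "continuous_on (snd ` W) (\<lambda>t. \<eta> / (T - t)\<^sup>2)"
    using s0 W\<Omega>(2) by (intro continuous_intros) auto
  have minW: "\<forall>x y t. (y, t) \<in> W \<longrightarrow> - v (x0, t0) + \<theta> t0 + 0 * (x0 \<bullet> x0) + K * ((x0 - y0) \<bullet> (x0 - y0))\<^sup>2 + f (u (y0, t0))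
     \<le> - v (x, t) + \<theta> t + 0 * (x \<bullet> x) + K * ((x - y) \<bullet> (x - y))\<^sup>2 + f (u (y, t))"
    using min W\<Omega> by (force simp: G_def W_def)
  note est = interior_minimum_estimates[OF V W(1,2) gmcf_classical_subset[OF u(2) W\<Omega>(1)] W(3) df
      continuous_on_const order_refl \<theta>' c\<theta>' order_refl less_imp_le[OF K] minW]
  have "\<eta> / (T - t0)\<^sup>2 < \<kappa>"
  proof (rule small[OF _ _ _ _ _ _ _ _ est])
    show "4 * K * ((x0 - y0) \<bullet> (x0 - y0)) * norm (x0 - y0) = 4 * K * ((x0 - y0) \<bullet> (x0 - y0)) * sqrt ((x0 - y0) \<bullet> (x0 - y0))"
      by (simp add: norm_eq_sqrt_inner)
  qed (use \<epsilon> \<rho> C in auto)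
  moreover have "\<kappa> \<le> \<eta> / (T - t0)\<^sup>2"
    unfolding \<kappa>_def using \<eta> t0 s0 T by (intro divide_left_mono power_mono) auto
  ultimately show False by linarith
qed

section \<open>Signed distance, initial data and measure-theoretic boundary\<close>

lemma ball_subset_of_frontier_disjoint:
  fixes x :: "'a::euclidean_space"
  assumes "x \<in> A" "ball x r \<inter> frontier A = {}"
  shows "ball x r \<subseteq> A"
proof (rule ccontr)
  assume "\<not> ball x r \<subseteq> A"
  then obtain w where "dist x w < r" "ball x r - A \<noteq> {}" by (auto simp: subset_iff)
  moreover from this have "0 < r" using zero_le_dist[of x w] by linarith
  ultimately have "ball x r - A \<noteq> {}" "x \<in> ball x r \<inter> A"
    using assms(1) by auto
  then show False
    using connected_Int_frontier[OF connected_ball] assms(2) by blast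
qed

text \<open>Truncation does no harm: its values are at least -1, so the assumption forces
  \<open>c \<le> 1\<close>, where the truncated and the full distance give the same
  condition.\<close>

lemma ball_subset_of_trunc_sdist_le:
  assumes "trunc_sdist A x \<le> - c" "0 < c"
  shows "ball x c \<subseteq> A"
proof -
  have A: "x \<in> A"
    using assms infdist_nonneg[of x "frontier A"] by (auto simp: trunc_sdist_def split: if_splits)
  moreover have "ball x c \<inter> frontier A = {}"
  proof (cases "frontier A = {}")
    case False
    then have "c \<le> infdist x (frontier A)"
      using assms A infdist_nonneg[of x "frontier A"] by (auto simp: trunc_sdist_def)
    then show ?thesis using infdist_le[of _ "frontier A" x] by force
  qed simp
  ultimately show ?thesis by (rule ball_subset_of_frontier_disjoint)
qed

text \<open>For \<open>x\<close> outside \<open>A\<close> the segment from \<open>x\<close> to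
  \<open>y\<close> meets the frontier; in particular the frontier is nonempty, which rules out the
  default value 1.\<close>

lemma trunc_sdist_le_norm:
  assumes "y \<in> A"
  shows "trunc_sdist A x \<le> norm (x - y)"
proof (cases "x \<in> A")
  case True
  then show ?thesis using infdist_nonneg[of x "frontier A"]
    by (auto simp: trunc_sdist_def intro: order_trans[OF _ norm_ge_zero])
next
  case False
  have "closed_segment x y \<inter> frontier A \<noteq> {}"
    using assms False by (intro connected_Int_frontier) auto
  then obtain z where z: "z \<in> closed_segment x y" "z \<in> frontier A" by blast
  then have "infdist x (frontier A) \<le> norm (x - y)"
    using infdist_le[OF z(2), of x] segment_bound(1)[OF z(1)] by (simp add: dist_norm norm_minus_commute)
  then show ?thesis using False z(2)
    by (auto simp: trunc_sdist_def intro: order_trans[OF _ norm_ge_zero])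
qed

lemma locally_lipschitz_on_imp_continuous_on:
  assumes "locally_lipschitz_on A f"
  shows "continuous_on A f"
  unfolding continuous_on_iff
proof (intro ballI allI impI)
  fix x and e :: real assume x: "x \<in> A" and e: "0 < e"
  obtain r K where r: "r > 0" "\<And>y z. y \<in> A \<inter> ball x r \<Longrightarrow> z \<in> A \<inter> ball x r \<Longrightarrow> \<bar>f y - f z\<bar> \<le> K * dist y z"
    using assms x unfolding locally_lipschitz_on_def by meson
  define d where "d = min r (e / (\<bar>K\<bar> + 1))"
  have "0 < d" using r e by (simp add: d_def)
  moreover have "dist (f y) (f x) < e" if "y \<in> A" "dist y x < d" for y
  proof -
    have "\<bar>f y - f x\<bar> \<le> K * dist y x"
      using that x r by (intro r(2)) (auto simp: d_def dist_commute)
    also have "\<dots> \<le> (\<bar>K\<bar> + 1) * dist y x" by (intro mult_right_mono) auto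
    also have "\<dots> < e" using that(2) by (simp add: d_def pos_less_divide_eq mult.commute)
    finally show ?thesis by (simp add: dist_real_def)
  qed
  ultimately show "\<exists>d>0. \<forall>y\<in>A. dist y x < d \<longrightarrow> dist (f y) (f x) < e" by blast
qed

lemma mboundary_eqI:
  fixes D E :: "'a::euclidean_space set"
  assumes "D \<in> sets lebesgue" "D \<subseteq> E" "negligible (E - D)"
  shows "mboundary E = mboundary D"
proof -
  have "emeasure lebesgue (E \<inter> ball x r) = emeasure lebesgue (D \<inter> ball x r)" for x r
  proof -
    have "(E - D) \<inter> ball x r \<in> null_sets lebesgue"
      using assms(3) negligible_iff_null_sets negligible_subset by (metis inf_le1)
    moreover have "E \<inter> ball x r = (D \<inter> ball x r) \<union> ((E - D) \<inter> ball x r)" using assms(2) by blast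
    moreover have "D \<inter> ball x r \<in> sets lebesgue" using assms(1) by auto
    ultimately show ?thesis by (simp add: emeasure_Un_null_set)
  qed
  then show ?thesis by (simp add: mboundary_def)
qed

theorem theorem9p1:
  fixes A :: "'a::euclidean_space set" and u0 :: "'a \<Rightarrow> real"
    and \<Omega> :: "('a \<times> real) set" and u :: "'a \<times> real \<Rightarrow> real"
    and v :: "'a \<times> real \<Rightarrow> real"
  assumes "open A"
    and "locally_lipschitz_on A u0"
    and "maximal_init A u0"
    and "constructed_srs A u0 \<Omega> u"
    and "levelset_solution v (trunc_sdist A)"
    and "\<forall>t\<ge>0. negligible {x. v (x, t) = 0}"
  shows "\<forall>t\<ge>0. mboundary (tslice \<Omega> t) = mboundary {x. v (x, t) < 0}"
proof (intro allI impI)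
  fix t :: real assume t: "0 \<le> t"
  have v: "supersol_test v" "supersol_test (\<lambda>p. - v p)" "continuous_on (UNIV \<times> {0..}) v"
    and v0: "\<And>x. v (x, 0) = trunc_sdist A x" and bdd: "bounded (v ` (UNIV \<times> {0..}))"
    using assms(5) ls_supersol_imp_supersol_test ls_subsol_imp_supersol_test
    unfolding levelset_solution_def by (auto intro: uniformly_continuous_imp_continuous)
  obtain C where C': "\<forall>y\<in>v ` (UNIV \<times> {0..}). norm y \<le> C" using bdd unfolding bounded_iff by blast
  have C: "\<bar>v (x, t)\<bar> \<le> C" if "0 \<le> t" for x t using C'[rule_format, of "v (x, t)"] that by simp
  have sol: "sing_resolving_solution A u0 \<Omega> u" using assms(4) by (simp add: constructed_srs_def)
  obtain U \<sigma> where U: "\<forall>L::nat. approx_entire_sol A u0 (real L) (U L)"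
    and lim: "\<forall>p. 0 \<le> snd p \<and> p \<notin> \<Omega> \<longrightarrow> filterlim (\<lambda>k. U (\<sigma> k) p) at_top sequentially"
    using assms(4) unfolding constructed_srs_def by (elim conjE exE) (rule that)
  \<comment> \<open>The height bound is the same for all indices \<open>k\<close>, so it contradicts
    the divergence of the approximations off \<open>\<Omega>\<close>.\<close>
  have "(x, t) \<in> \<Omega>" if neg: "v (x, t) < 0" for x
  proof (rule ccontr)
    assume "(x, t) \<notin> \<Omega>"
    then have "filterlim (\<lambda>k. U (\<sigma> k) (x, t)) at_top sequentially" using lim t by simp
    moreover obtain z where z: "\<And>U L. continuous_on (UNIV \<times> {0..}) U \<Longrightarrow> gmcf_classical (UNIV \<times> {0<..}) U \<Longrightarrow>
     (\<And>x. U (x, 0) = cut_init A u0 L x) \<Longrightarrow> U (x, t) \<le> z"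
      using height_bound_on_negative_set[OF v(1,3) C locally_lipschitz_on_imp_continuous_on[OF assms(2)] _ neg t]
        ball_subset_of_trunc_sdist_le unfolding v0 by metis
    ultimately have "\<forall>\<^sub>F k in sequentially. z + 1 \<le> U (\<sigma> k) (x, t)"
      by (simp add: filterlim_at_top)
    then obtain k where "z + 1 \<le> U (\<sigma> k) (x, t)"
      using eventually_happens trivial_limit_sequentially by blast
    moreover have "U (\<sigma> k) (x, t) \<le> z"
      using U[rule_format, of "\<sigma> k"] unfolding approx_entire_sol_def by (intro z) auto
    ultimately show False by linarith
  qed
  then have sub: "{x. v (x, t) < 0} \<subseteq> tslice \<Omega> t" by (auto simp: tslice_def)
  have "v (x, t) \<le> 0" if "(x, t) \<in> \<Omega>" for x
    by (rule nonpositive_on_solution_domain[OF v(2,3) C sol _ that]) (auto simp: v0 intro: trunc_sdist_le_norm)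
  then have "tslice \<Omega> t - {x. v (x, t) < 0} \<subseteq> {x. v (x, t) = 0}"
    by (force simp: tslice_def)
  then have "negligible (tslice \<Omega> t - {x. v (x, t) < 0})"
    using assms(6) t negligible_subset by blast
  moreover have "continuous_on UNIV (\<lambda>x. v (x, t))"
    by (rule continuous_on_compose2[OF v(3)]) (use t in \<open>auto intro!: continuous_intros\<close>)
  then have "open {x. v (x, t) < 0}" by (intro open_Collect_less) auto
  then have "{x. v (x, t) < 0} \<in> sets lebesgue" by simp
  ultimately show "mboundary (tslice \<Omega> t) = mboundary {x. v (x, t) < 0}"
    using mboundary_eqI[OF _ sub] by blast
qed

end
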